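(* If a statistical manifold $(M,g,\nabla,\nabla^{*})$ is conjugate Ricci-symmetric, then $\nabla$ is equiaffine.
   Context: A statistical manifold $(M,g,\nabla)$ is a smooth manifold $M$ with a Riemannian metric $g$ and a torsion-free affine connection $\nabla$ such that the cubic form $Q(X,Y,Z)=(\nabla_X g)(Y,Z)$ is symmetric in all of $X,Y,Z$. The dual connection $\nabla^{*}$ of $\nabla$ is defined by $X\,g(Y,Z)=g(\nabla_X Y,Z)+g(Y,\nabla^{*}_X Z)$; it is again torsion-free, and one also writes $(M,g,\nabla,\nabla^{*})$ for the statistical manifold. The curvature tensor field of $\nabla$ is $R(X,Y)Z=\nabla_X\nabla_Y Z-\nabla_Y\nabla_X Z-\nabla_{[X,Y]}Z$, and its Ricci tensor is $Ric(Y,Z)=\mathrm{tr}\{X\mapsto R(X,Y)Z\}$; $Ric^{*}$ is defined in the same way from $\nabla^{*}$. The statistical manifold is called conjugate Ricci-symmetric if $Ric(Y,Z)=Ric^{*}(Y,Z)$ for all vector fields $Y,Z$ on $M$. A torsion-free affine connection is called (locally) equiaffine if around each point of $M$ there is a volume form $\omega$ (a nowhere vanishing form of top degree), defined on a neighbourhood of the point, which is parallel with respect to the connection (i.e. $\nabla\omega=0$). It is a known fact that a torsion-free affine connection is equiaffine in this sense if and only if its Ricci tensor is symmetric. *)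

theory Defs
  imports "HOL-Analysis.Analysis" "HOL-Library.Function_Algebras"
begin

instantiation "fun" :: (type, real_vector) real_vector
begin

definition scaleR_fun :: "real \<Rightarrow> ('a \<Rightarrow> 'b) \<Rightarrow> 'a \<Rightarrow> 'b"
  where "scaleR_fun c f = (\<lambda>x. c *\<^sub>R f x)"

instance
  by standard (simp_all add: scaleR_fun_def fun_eq_iff algebra_simps)

end

text \<open>\<open>Ck_on k S f\<close> is meant for open \<open>S\<close>. As the domain is finite-dimensional, having
  directional derivatives of class \<open>C\<^sup>k\<close> is the same as having a derivative of class \<open>C\<^sup>k\<close>.\<close>

primrec Ck_on :: "nat \<Rightarrow> 'a::euclidean_space set \<Rightarrow> ('a \<Rightarrow> 'b::real_normed_vector) \<Rightarrow> bool"
  where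
    "Ck_on 0 S f \<longleftrightarrow> continuous_on S f"
  | "Ck_on (Suc k) S f \<longleftrightarrow>
      (\<forall>x\<in>S. f differentiable (at x)) \<and> (\<forall>v. Ck_on k S (\<lambda>x. frechet_derivative f (at x) v))"

definition smooth_on :: "'a::euclidean_space set \<Rightarrow> ('a \<Rightarrow> 'b::real_normed_vector) \<Rightarrow> bool"
  where "smooth_on S f \<longleftrightarrow> (\<forall>k. Ck_on k S f)"

text \<open>The trace of a linear endomorphism \<open>T\<close> of a finite-dimensional subspace \<open>V\<close>, computed in
  an arbitrary basis; \<open>T\<close> may be arbitrary outside \<open>V\<close>.\<close>

definition trace_on :: "'v::real_vector set \<Rightarrow> ('v \<Rightarrow> 'v) \<Rightarrow> real"
  where "trace_on V T =
    (let B = (SOME B. independent B \<and> span B = V) in \<Sum>b\<in>B. representation B (T b) b)"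

definition linear_map_on :: "'v::real_vector set \<Rightarrow> ('v \<Rightarrow> real) \<Rightarrow> bool"
  where "linear_map_on V h \<longleftrightarrow>
    (\<forall>u\<in>V. \<forall>v\<in>V. h (u + v) = h u + h v) \<and> (\<forall>c. \<forall>v\<in>V. h (c *\<^sub>R v) = c * h v)"

text \<open>A tangent vector at \<open>p\<close> is a derivation at \<open>p\<close> of the functions that are smooth
  near \<open>p\<close>, extended by zero to all other functions.\<close>

type_synonym 'm tangent = "('m \<Rightarrow> real) \<Rightarrow> real"
type_synonym 'm vfield = "'m \<Rightarrow> 'm tangent"

definition apply_vf :: "'m vfield \<Rightarrow> ('m \<Rightarrow> real) \<Rightarrow> 'm \<Rightarrow> real"
  where "apply_vf X f = (\<lambda>p. X p f)"

definition scale_vf :: "('m \<Rightarrow> real) \<Rightarrow> 'm vfield \<Rightarrow> 'm vfield"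
  where "scale_vf f X = (\<lambda>p. f p *\<^sub>R X p)"

text \<open>A smooth manifold of dimension \<open>CARD('n)\<close>; a chart is a pair of its domain and its
  coordinate map, and the atlas \<open>A\<close> need not be maximal.\<close>

locale smooth_manifold =
  fixes M :: "'m topology"
    and A :: "('m set \<times> ('m \<Rightarrow> real^'n)) set"
  assumes hausdorff: "Hausdorff_space M"
    and second_countable: "second_countable M"
    and charts_cover: "(\<Union>(U, \<phi>)\<in>A. U) = topspace M"
    and chart_domain: "(U, \<phi>) \<in> A \<Longrightarrow> openin M U"
    and chart_range: "(U, \<phi>) \<in> A \<Longrightarrow> open (\<phi> ` U)"
    and chart_homeo:
      "(U, \<phi>) \<in> A \<Longrightarrow> homeomorphic_map (subtopology M U) (top_of_set (\<phi> ` U)) \<phi>"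
    and transition_smooth:
      "(U, \<phi>) \<in> A \<Longrightarrow> (V, \<psi>) \<in> A \<Longrightarrow> smooth_on (\<phi> ` (U \<inter> V)) (\<psi> \<circ> inv_into U \<phi>)"
begin

definition smooth_fun_on :: "'m set \<Rightarrow> ('m \<Rightarrow> real) \<Rightarrow> bool"
  where "smooth_fun_on W f \<longleftrightarrow>
    openin M W \<and> (\<forall>(U, \<phi>)\<in>A. smooth_on (\<phi> ` (U \<inter> W)) (f \<circ> inv_into U \<phi>))"

definition smooth_near :: "'m \<Rightarrow> ('m \<Rightarrow> real) \<Rightarrow> bool"
  where "smooth_near p f \<longleftrightarrow> (\<exists>W. p \<in> W \<and> smooth_fun_on W f)"

text \<open>The Leibniz rule forces a tangent vector to depend only on the germ of its argument:
  the indicator function of the complement of a neighbourhood of \<open>p\<close> is smooth near \<open>p\<close>.\<close>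

definition tangent_space :: "'m \<Rightarrow> 'm tangent set"
  where "tangent_space p =
    {v. (\<forall>f h. smooth_near p f \<longrightarrow> smooth_near p h \<longrightarrow>
            v (f + h) = v f + v h \<and> v (f * h) = f p * v h + h p * v f) \<and>
        (\<forall>c f. smooth_near p f \<longrightarrow> v (c *\<^sub>R f) = c * v f) \<and>
        (\<forall>f. \<not> smooth_near p f \<longrightarrow> v f = 0)}"

text \<open>Smooth vector fields on \<open>M\<close>. They are set to zero outside \<open>topspace M\<close>, so that equal
  vector fields are equal as HOL functions.\<close>

definition vector_field :: "'m vfield \<Rightarrow> bool"
  where "vector_field X \<longleftrightarrow>
    (\<forall>p\<in>topspace M. X p \<in> tangent_space p) \<and>
    (\<forall>W f. smooth_fun_on W f \<longrightarrow> smooth_fun_on W (apply_vf X f)) \<and>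
    (\<forall>p. p \<notin> topspace M \<longrightarrow> X p = 0)"

definition lie_bracket :: "'m vfield \<Rightarrow> 'm vfield \<Rightarrow> 'm vfield"
  where "lie_bracket X Y = (\<lambda>p f.
    if smooth_near p f then X p (apply_vf Y f) - Y p (apply_vf X f) else 0)"

definition riemannian_metric :: "('m \<Rightarrow> 'm tangent \<Rightarrow> 'm tangent \<Rightarrow> real) \<Rightarrow> bool"
  where "riemannian_metric g \<longleftrightarrow>
    (\<forall>p\<in>topspace M.
      (\<forall>u\<in>tangent_space p. linear_map_on (tangent_space p) (g p u)) \<and>
      (\<forall>u\<in>tangent_space p. \<forall>v\<in>tangent_space p. g p u v = g p v u) \<and>
      (\<forall>v\<in>tangent_space p. v \<noteq> 0 \<longrightarrow> g p v v > 0)) \<and>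
    (\<forall>X Y. vector_field X \<longrightarrow> vector_field Y \<longrightarrow>
      smooth_fun_on (topspace M) (\<lambda>p. g p (X p) (Y p)))"

definition affine_connection :: "('m vfield \<Rightarrow> 'm vfield \<Rightarrow> 'm vfield) \<Rightarrow> bool"
  where "affine_connection nab \<longleftrightarrow>
    (\<forall>X Y. vector_field X \<longrightarrow> vector_field Y \<longrightarrow> vector_field (nab X Y)) \<and>
    (\<forall>X X' Y. vector_field X \<longrightarrow> vector_field X' \<longrightarrow> vector_field Y \<longrightarrow>
      nab (X + X') Y = nab X Y + nab X' Y) \<and>
    (\<forall>X Y Y'. vector_field X \<longrightarrow> vector_field Y \<longrightarrow> vector_field Y' \<longrightarrow>
      nab X (Y + Y') = nab X Y + nab X Y') \<and>
    (\<forall>f X Y. smooth_fun_on (topspace M) f \<longrightarrow> vector_field X \<longrightarrow> vector_field Y \<longrightarrow>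
      nab (scale_vf f X) Y = scale_vf f (nab X Y) \<and>
      nab X (scale_vf f Y) = scale_vf (apply_vf X f) Y + scale_vf f (nab X Y))"

definition torsion_free :: "('m vfield \<Rightarrow> 'm vfield \<Rightarrow> 'm vfield) \<Rightarrow> bool"
  where "torsion_free nab \<longleftrightarrow>
    (\<forall>X Y. vector_field X \<longrightarrow> vector_field Y \<longrightarrow> nab X Y - nab Y X = lie_bracket X Y)"

definition cubic_form ::
    "('m \<Rightarrow> 'm tangent \<Rightarrow> 'm tangent \<Rightarrow> real) \<Rightarrow> ('m vfield \<Rightarrow> 'm vfield \<Rightarrow> 'm vfield) \<Rightarrow>
      'm vfield \<Rightarrow> 'm vfield \<Rightarrow> 'm vfield \<Rightarrow> 'm \<Rightarrow> real"
  where "cubic_form g nab X Y Z p =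
    X p (\<lambda>q. g q (Y q) (Z q)) - g p (nab X Y p) (Z p) - g p (Y p) (nab X Z p)"

definition dual_connection ::
    "('m \<Rightarrow> 'm tangent \<Rightarrow> 'm tangent \<Rightarrow> real) \<Rightarrow> ('m vfield \<Rightarrow> 'm vfield \<Rightarrow> 'm vfield) \<Rightarrow>
      ('m vfield \<Rightarrow> 'm vfield \<Rightarrow> 'm vfield) \<Rightarrow> bool"
  where "dual_connection g nab nab' \<longleftrightarrow>
    affine_connection nab' \<and>
    (\<forall>X Y Z. vector_field X \<longrightarrow> vector_field Y \<longrightarrow> vector_field Z \<longrightarrow>
      (\<forall>p\<in>topspace M.
        X p (\<lambda>q. g q (Y q) (Z q)) = g p (nab X Y p) (Z p) + g p (Y p) (nab' X Z p)))"

definition curvature ::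
    "('m vfield \<Rightarrow> 'm vfield \<Rightarrow> 'm vfield) \<Rightarrow> 'm vfield \<Rightarrow> 'm vfield \<Rightarrow> 'm vfield \<Rightarrow> 'm vfield"
  where "curvature nab X Y Z =
    nab X (nab Y Z) - nab Y (nab X Z) - nab (lie_bracket X Y) Z"

text \<open>Since \<open>curvature\<close> is tensorial, its value at \<open>p\<close> depends on \<open>X\<close> only through \<open>X p\<close>; to
  get an endomorphism of the tangent space at \<open>p\<close>, the vector \<open>v\<close> is extended to any vector field.\<close>

definition Ric ::
    "('m vfield \<Rightarrow> 'm vfield \<Rightarrow> 'm vfield) \<Rightarrow> 'm vfield \<Rightarrow> 'm vfield \<Rightarrow> 'm \<Rightarrow> real"
  where "Ric nab Y Z p =
    trace_on (tangent_space p)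
      (\<lambda>v. curvature nab (SOME X. vector_field X \<and> X p = v) Y Z p)"

definition conjugate_Ricci_symmetric ::
    "('m vfield \<Rightarrow> 'm vfield \<Rightarrow> 'm vfield) \<Rightarrow> ('m vfield \<Rightarrow> 'm vfield \<Rightarrow> 'm vfield) \<Rightarrow> bool"
  where "conjugate_Ricci_symmetric nab nab' \<longleftrightarrow>
    (\<forall>Y Z. vector_field Y \<longrightarrow> vector_field Z \<longrightarrow> (\<forall>p\<in>topspace M. Ric nab Y Z p = Ric nab' Y Z p))"

text \<open>Forms of top degree take an \<open>'n\<close>-indexed family of tangent vectors, \<open>CARD('n)\<close> being the
  dimension of the manifold. Smoothness and parallelism of a form on \<open>U\<close> are tested at the points
  of \<open>U\<close> with vector fields on \<open>M\<close>; this suffices because every vector field on \<open>U\<close> agrees near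
  any given point of \<open>U\<close> with one on \<open>M\<close>.\<close>

definition volume_form_on :: "'m set \<Rightarrow> ('m \<Rightarrow> ('n \<Rightarrow> 'm tangent) \<Rightarrow> real) \<Rightarrow> bool"
  where "volume_form_on U \<omega> \<longleftrightarrow>
    (\<forall>p\<in>U.
      (\<forall>v. (\<forall>i. v i \<in> tangent_space p) \<longrightarrow>
        (\<forall>i. linear_map_on (tangent_space p) (\<lambda>u. \<omega> p (v(i := u)))) \<and>
        (\<forall>i j. i \<noteq> j \<longrightarrow> v i = v j \<longrightarrow> \<omega> p v = 0)) \<and>
      (\<exists>v. (\<forall>i. v i \<in> tangent_space p) \<and> \<omega> p v \<noteq> 0)) \<and>
    (\<forall>Y. (\<forall>i. vector_field (Y i)) \<longrightarrow> smooth_fun_on U (\<lambda>p. \<omega> p (\<lambda>i. Y i p)))"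

definition cov_deriv_form ::
    "('m vfield \<Rightarrow> 'm vfield \<Rightarrow> 'm vfield) \<Rightarrow> ('m \<Rightarrow> ('n \<Rightarrow> 'm tangent) \<Rightarrow> real) \<Rightarrow>
      'm vfield \<Rightarrow> ('n \<Rightarrow> 'm vfield) \<Rightarrow> 'm \<Rightarrow> real"
  where "cov_deriv_form nab \<omega> X Y p =
    X p (\<lambda>q. \<omega> q (\<lambda>j. Y j q)) - (\<Sum>i\<in>UNIV. \<omega> p ((\<lambda>j. Y j p)(i := nab X (Y i) p)))"

definition parallel_on ::
    "('m vfield \<Rightarrow> 'm vfield \<Rightarrow> 'm vfield) \<Rightarrow> 'm set \<Rightarrow> ('m \<Rightarrow> ('n \<Rightarrow> 'm tangent) \<Rightarrow> real) \<Rightarrow> bool"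
  where "parallel_on nab U \<omega> \<longleftrightarrow>
    (\<forall>X Y. vector_field X \<longrightarrow> (\<forall>i. vector_field (Y i)) \<longrightarrow>
      (\<forall>p\<in>U. cov_deriv_form nab \<omega> X Y p = 0))"

definition equiaffine :: "('m vfield \<Rightarrow> 'm vfield \<Rightarrow> 'm vfield) \<Rightarrow> bool"
  where "equiaffine nab \<longleftrightarrow>
    affine_connection nab \<and> torsion_free nab \<and>
    (\<forall>p\<in>topspace M. \<exists>U \<omega>. openin M U \<and> p \<in> U \<and> volume_form_on U \<omega> \<and> parallel_on nab U \<omega>)"

end

locale statistical_manifold = smooth_manifold M A
  for M :: "'m topology" and A :: "('m set \<times> ('m \<Rightarrow> real^'n)) set" +
  fixes g :: "'m \<Rightarrow> 'm tangent \<Rightarrow> 'm tangent \<Rightarrow> real"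
    and nab :: "'m vfield \<Rightarrow> 'm vfield \<Rightarrow> 'm vfield"
  assumes metric: "riemannian_metric g"
    and connection: "affine_connection nab"
    and torsion_free: "torsion_free nab"
    and cubic_form_symmetric:
      "vector_field X \<Longrightarrow> vector_field Y \<Longrightarrow> vector_field Z \<Longrightarrow> p \<in> topspace M \<Longrightarrow>
        cubic_form g nab X Y Z p = cubic_form g nab Y X Z p \<and>
        cubic_form g nab X Y Z p = cubic_form g nab X Z Y p"

end

theory Submission
  imports Defs
begin

text \<open>By the first Bianchi identity the antisymmetric part of \<open>Ric\<close> is \<open>- tr R(Y,Z)\<close>. Duality gives
  \<open>g(R(Y,Z)U,W) = - g(U,R*(Y,Z)W)\<close>, hence \<open>tr R* = - tr R\<close>, so \<open>Ric = Ric*\<close> forces \<open>tr R = 0\<close>.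
  In a coordinate frame \<open>tr R\<close> is the exterior derivative of the 1-form \<open>trace_form\<close>, so locally
  \<open>trace_form = dP\<close>, and \<open>exp P\<close> times the coordinate volume form is parallel.\<close>

section \<open>Calculus of smooth functions\<close>

text \<open>A connection here acts only on vector fields defined on all of M, so its locality has to
  be proved. Cut-off functions supply global fields that equal the coordinate fields near a point,
  and they show how far \<open>nab X Y\<close> at a point depends on X and on Y; this is why smooth
  bumps have to be built. A coordinate frame is preferred to an orthonormal one because its brackets
  vanish: the curvature loses its bracket term, and in its trace the terms quadratic in the
  connection cancel as in tr(AB) = tr(BA), so that only derivatives of \<open>trace_form\<close>
  remain. The Bianchi identity is applied to both connections, whereas
  \<open>dual_connection\<close> does not say that \<open>nab'\<close> has no torsion; this has to
  be extracted from the symmetry of the cubic form. The exponential comes from the coordinate volume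
  form: its derivative along X is minus trace_form(X) times itself, so a density h makes it parallel
  exactly when dh = h trace_form. Poincare's lemma is applied on a convex domain, hence the
  neighbourhoods that a chart maps onto a ball.\<close>

lemma Ck_on_subset: "Ck_on k S f \<Longrightarrow> T \<subseteq> S \<Longrightarrow> Ck_on k T f"
  by (induction k arbitrary: f) (auto intro: continuous_on_subset)

text \<open>\<open>frechet_derivative\<close> is a choice from the set of derivatives; both
  functions have the same set at \<open>x\<close>, so the choices agree even if that set is
  empty.\<close>

lemma frechet_derivative_cong_open:
  assumes "open S" "x \<in> S" "\<And>x. x \<in> S \<Longrightarrow> f x = g x"
  shows "frechet_derivative f (at x) = frechet_derivative g (at x)"
proof -
  have "(f has_derivative D) (at x) \<longleftrightarrow> (g has_derivative D) (at x)" for D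
    using assms by (auto intro: has_derivative_transform_within_open[of _ _ x UNIV S])
  then show ?thesis
    by (simp add: frechet_derivative_def)
qed

lemma Ck_on_cong:
  assumes "open S" "\<And>x. x \<in> S \<Longrightarrow> f x = g x"
  shows "Ck_on k S f \<longleftrightarrow> Ck_on k S g"
  using assms(2)
proof (induction k arbitrary: f g)
  case 0
  then show ?case by (auto cong: continuous_on_cong)
next
  case (Suc k)
  have "f differentiable at x \<longleftrightarrow> g differentiable at x" if "x \<in> S" for x
    unfolding differentiable_def
    using Suc.prems that \<open>open S\<close>
    by (metis has_derivative_transform_within_open)
  moreover have "Ck_on k S (\<lambda>x. frechet_derivative f (at x) v)
      \<longleftrightarrow> Ck_on k S (\<lambda>x. frechet_derivative g (at x) v)" for v
    using Suc.prems \<open>open S\<close>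
    by (intro Suc.IH) (metis frechet_derivative_cong_open)
  ultimately show ?case by simp
qed

lemma Ck_on_Union:
  assumes "\<And>T. T \<in> \<T> \<Longrightarrow> open T" "\<And>T. T \<in> \<T> \<Longrightarrow> Ck_on k T f"
  shows "Ck_on k (\<Union>\<T>) f"
  using assms(2)
proof (induction k arbitrary: f)
  case 0
  then show ?case using assms(1) by (auto intro: continuous_on_open_Union)
qed auto

text \<open>This frees the inductions from the choice operator: each closure property below is an
  induction on \<open>k\<close> in which the derivative is written down explicitly and is seen to be
  of class k by the induction hypothesis.\<close>

lemma Ck_on_SucI:
  assumes "open S" "\<And>x. x \<in> S \<Longrightarrow> (f has_derivative f' x) (at x)"
    "\<And>v. Ck_on k S (\<lambda>x. f' x v)"
  shows "Ck_on (Suc k) S f"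
proof -
  have "frechet_derivative f (at x) = f' x" if "x \<in> S" for x
    using assms(2)[OF that] frechet_derivative_at by metis
  then have "Ck_on k S (\<lambda>x. frechet_derivative f (at x) v)" for v
    using assms(3)[of v] Ck_on_cong[OF assms(1), of "\<lambda>x. frechet_derivative f (at x) v" "\<lambda>x. f' x v"]
    by simp
  then show ?thesis
    using assms(2) by (auto simp: differentiable_def)
qed

lemma Ck_on_SucD:
  assumes "Ck_on (Suc k) S f"
  shows "x \<in> S \<Longrightarrow> (f has_derivative frechet_derivative f (at x)) (at x)"
    and "Ck_on k S (\<lambda>x. frechet_derivative f (at x) v)"
  using assms by (auto simp: frechet_derivative_works)

lemma Ck_on_less: "Ck_on (Suc k) S f \<Longrightarrow> Ck_on k S f"
proof (induction k arbitrary: f)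
  case 0
  then show ?case
    by (simp add: continuous_at_imp_continuous_on differentiable_imp_continuous_within)
next
  case (Suc k)
  from Suc.prems have "Ck_on (Suc k) S (\<lambda>x. frechet_derivative f (at x) v)" for v
    by (rule Ck_on_SucD(2))
  then have "Ck_on k S (\<lambda>x. frechet_derivative f (at x) v)" for v
    by (rule Suc.IH)
  moreover have "\<forall>x\<in>S. f differentiable (at x)"
    using Suc.prems by simp
  ultimately show ?case by simp
qed

lemma Ck_on_const [simp]: "Ck_on k S (\<lambda>x. c)"
  by (induction k arbitrary: c) auto

lemma Ck_on_bounded_linear:
  assumes "open S" "bounded_linear L" "Ck_on k S f"
  shows "Ck_on k S (\<lambda>x. L (f x))"
  using assms(3)
proof (induction k arbitrary: f)
  case 0
  then show ?case
    using assms(2) by (simp add: bounded_linear.continuous_on)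
next
  case (Suc k)
  show ?case
  proof (rule Ck_on_SucI[OF assms(1)])
    show "((\<lambda>x. L (f x)) has_derivative (\<lambda>v. L (frechet_derivative f (at x) v))) (at x)"
      if "x \<in> S" for x
      using Ck_on_SucD(1)[OF Suc.prems that] bounded_linear.has_derivative[OF assms(2)] by blast
    show "Ck_on k S (\<lambda>x. L (frechet_derivative f (at x) v))" for v
      using Suc by (blast intro: Ck_on_SucD(2))
  qed
qed

lemma Ck_on_ident: "open S \<Longrightarrow> Ck_on k S (\<lambda>x. x)"
proof (cases k)
  case (Suc m)
  assume "open S"
  then show ?thesis
    unfolding Suc by (rule Ck_on_SucI[where f' = "\<lambda>_ v. v"]) auto
qed simp

lemma Ck_on_linear: "open S \<Longrightarrow> bounded_linear L \<Longrightarrow> Ck_on k S L"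
  using Ck_on_bounded_linear[OF _ _ Ck_on_ident] by blast

lemma Ck_on_add:
  assumes "open S" "Ck_on k S f" "Ck_on k S g"
  shows "Ck_on k S (\<lambda>x. f x + g x)"
  using assms(2,3)
proof (induction k arbitrary: f g)
  case 0
  then show ?case by (simp add: continuous_on_add)
next
  case (Suc k)
  show ?case
  proof (rule Ck_on_SucI[OF assms(1)])
    show "((\<lambda>x. f x + g x) has_derivative
        (\<lambda>v. frechet_derivative f (at x) v + frechet_derivative g (at x) v)) (at x)"
      if "x \<in> S" for x
      using Suc.prems that by (intro has_derivative_add Ck_on_SucD(1))
    show "Ck_on k S (\<lambda>x. frechet_derivative f (at x) v + frechet_derivative g (at x) v)" for v
      using Suc by (blast intro: Ck_on_SucD(2))
  qed
qed

lemma Ck_on_scaleR: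
  fixes f :: "'a::euclidean_space \<Rightarrow> real"
  assumes "open S" "Ck_on k S f" "Ck_on k S g"
  shows "Ck_on k S (\<lambda>x. f x *\<^sub>R g x)"
  using assms(2,3)
proof (induction k arbitrary: f g)
  case 0
  then show ?case by (simp add: continuous_on_scaleR)
next
  case (Suc k)
  show ?case
  proof (rule Ck_on_SucI[OF assms(1)])
    show "((\<lambda>x. f x *\<^sub>R g x) has_derivative
        (\<lambda>v. f x *\<^sub>R frechet_derivative g (at x) v + frechet_derivative f (at x) v *\<^sub>R g x)) (at x)"
      if "x \<in> S" for x
      using Suc.prems that by (intro has_derivative_scaleR Ck_on_SucD(1))
    show "Ck_on k S (\<lambda>x. f x *\<^sub>R frechet_derivative g (at x) v
        + frechet_derivative f (at x) v *\<^sub>R g x)" for v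
      using Suc by (intro Ck_on_add assms(1)) (blast intro: Ck_on_SucD(2) Ck_on_less)+
  qed
qed

lemma Ck_on_sum:
  assumes "open S" "\<And>i. i \<in> I \<Longrightarrow> Ck_on k S (f i)"
  shows "Ck_on k S (\<lambda>x. \<Sum>i\<in>I. f i x)"
  using assms(2)
  by (induction I rule: infinite_finite_induct) (auto intro: Ck_on_add assms(1))

lemma Ck_on_compose:
  fixes f :: "'b::euclidean_space \<Rightarrow> 'c::real_normed_vector" and h :: "'a::euclidean_space \<Rightarrow> 'b"
  assumes "open S" "Ck_on k T f" "Ck_on k S h" "h ` S \<subseteq> T"
  shows "Ck_on k S (\<lambda>x. f (h x))"
  using assms(2,3)
proof (induction k arbitrary: f)
  case 0
  then show ?case
    using continuous_on_compose2[of T f S h] assms(4) by simp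
next
  case (Suc k)
  \<comment> \<open>In the chain rule the direction \<open>frechet_derivative h (at x) v\<close>
    moves with \<open>x\<close>, while \<open>Ck_on\<close> controls derivatives in fixed directions
    only. Expanding it in \<open>Basis\<close> leaves fixed directions with coefficients of class
    k.\<close>
  let ?D = "\<lambda>x v. \<Sum>b\<in>Basis. (frechet_derivative h (at x) v \<bullet> b) *\<^sub>R frechet_derivative f (at (h x)) b"
  show ?case
  proof (rule Ck_on_SucI[OF assms(1), where f' = ?D])
    show "((\<lambda>x. f (h x)) has_derivative ?D x) (at x)" if "x \<in> S" for x
    proof -
      have f: "(f has_derivative frechet_derivative f (at (h x))) (at (h x))"
        using Ck_on_SucD(1)[OF Suc.prems(1)] that assms(4) by blast
      have h: "(h has_derivative frechet_derivative h (at x)) (at x)"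
        using Ck_on_SucD(1)[OF Suc.prems(2) that] .
      have "frechet_derivative f (at (h x)) (frechet_derivative h (at x) v) = ?D x v" for v
        by (subst euclidean_representation[symmetric, of "frechet_derivative h (at x) v"])
          (simp only: linear_sum[OF has_derivative_linear[OF f]]
            linear_scale[OF has_derivative_linear[OF f]])
      then show ?thesis
        using has_derivative_compose[OF h f] by (simp add: fun_eq_iff)
    qed
    show "Ck_on k S (\<lambda>x. ?D x v)" for v
    proof (intro Ck_on_sum Ck_on_scaleR assms(1))
      show "Ck_on k S (\<lambda>x. frechet_derivative h (at x) v \<bullet> b)" for b
        by (rule Ck_on_bounded_linear[OF assms(1) bounded_linear_inner_left])
          (rule Ck_on_SucD(2)[OF Suc.prems(2)])
      show "Ck_on k S (\<lambda>x. frechet_derivative f (at (h x)) b)" for b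
        using Suc by (blast intro: Ck_on_SucD(2) Ck_on_less)
    qed
  qed
qed

lemma smooth_on_subset: "smooth_on S f \<Longrightarrow> T \<subseteq> S \<Longrightarrow> smooth_on T f"
  by (auto simp: smooth_on_def intro: Ck_on_subset)

lemma smooth_on_cong:
  "open S \<Longrightarrow> (\<And>x. x \<in> S \<Longrightarrow> f x = g x) \<Longrightarrow> smooth_on S f \<longleftrightarrow> smooth_on S g"
  unfolding smooth_on_def using Ck_on_cong by blast

lemma smooth_on_Union:
  "(\<And>T. T \<in> \<T> \<Longrightarrow> open T) \<Longrightarrow> (\<And>T. T \<in> \<T> \<Longrightarrow> smooth_on T f) \<Longrightarrow> smooth_on (\<Union>\<T>) f"
  unfolding smooth_on_def using Ck_on_Union by blast

lemma smooth_on_imp_continuous_on: "smooth_on S f \<Longrightarrow> continuous_on S f"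
  by (metis Ck_on.simps(1) smooth_on_def)

lemma smooth_on_has_derivative:
  "smooth_on S f \<Longrightarrow> x \<in> S \<Longrightarrow> (f has_derivative frechet_derivative f (at x)) (at x)"
  unfolding smooth_on_def using Ck_on_SucD(1) by blast

lemma smooth_on_frechet_derivative:
  "smooth_on S f \<Longrightarrow> smooth_on S (\<lambda>x. frechet_derivative f (at x) v)"
  unfolding smooth_on_def using Ck_on_SucD(2) by blast

lemma smooth_onI:
  assumes "open S" "\<And>x. x \<in> S \<Longrightarrow> (f has_derivative f' x) (at x)"
    "\<And>v. smooth_on S (\<lambda>x. f' x v)"
  shows "smooth_on S f"
  unfolding smooth_on_def
proof
  fix k
  have "Ck_on (Suc k) S f"
    using assms by (intro Ck_on_SucI) (auto simp: smooth_on_def)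
  then show "Ck_on k S f" by (rule Ck_on_less)
qed

lemma smooth_on_const [simp]: "smooth_on S (\<lambda>x. c)"
  by (simp add: smooth_on_def)

lemma smooth_on_linear: "open S \<Longrightarrow> bounded_linear L \<Longrightarrow> smooth_on S L"
  by (simp add: smooth_on_def Ck_on_linear)

lemma smooth_on_add:
  "open S \<Longrightarrow> smooth_on S f \<Longrightarrow> smooth_on S g \<Longrightarrow> smooth_on S (\<lambda>x. f x + g x)"
  by (simp add: smooth_on_def Ck_on_add)

lemma smooth_on_mult:
  fixes f g :: "'a::euclidean_space \<Rightarrow> real"
  shows "open S \<Longrightarrow> smooth_on S f \<Longrightarrow> smooth_on S g \<Longrightarrow> smooth_on S (\<lambda>x. f x * g x)"
  using Ck_on_scaleR[of S _ f g] by (simp add: smooth_on_def)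

lemma smooth_on_sum:
  "open S \<Longrightarrow> (\<And>i. i \<in> I \<Longrightarrow> smooth_on S (f i)) \<Longrightarrow> smooth_on S (\<lambda>x. \<Sum>i\<in>I. f i x)"
  by (simp add: smooth_on_def Ck_on_sum)

lemma smooth_on_compose:
  "open S \<Longrightarrow> smooth_on T f \<Longrightarrow> smooth_on S h \<Longrightarrow> h ` S \<subseteq> T \<Longrightarrow> smooth_on S (\<lambda>x. f (h x))"
  unfolding smooth_on_def using Ck_on_compose by blast

lemma smooth_on_exp: "smooth_on UNIV (exp :: real \<Rightarrow> real)"
proof -
  \<comment> \<open>The factor \<open>c\<close> makes the family closed under differentiation: it
    absorbs the direction \<open>v\<close>, a real number.\<close>
  have "Ck_on k UNIV (\<lambda>x. c * exp x :: real)" for k c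
  proof (induction k arbitrary: c)
    case 0
    then show ?case by (auto intro!: continuous_intros)
  next
    case (Suc k)
    show ?case
    proof (rule Ck_on_SucI[where f' = "\<lambda>x v. (c * v) * exp x"])
      show "((\<lambda>x. c * exp x) has_derivative (\<lambda>v. c * v * exp x)) (at x)" for x :: real
        by (auto intro!: derivative_eq_intros)
    qed (use Suc in auto)
  qed
  from this[of _ 1] show ?thesis by (simp add: smooth_on_def)
qed

text \<open>The exponent \<open>k\<close> makes the family closed under differentiation.\<close>

definition flat_fun :: "nat \<Rightarrow> real \<Rightarrow> real"
  where "flat_fun k x = (if x > 0 then exp (- inverse x) * inverse x ^ k else 0)"

text \<open>From the right, replacing x by its inverse turns this into the decay of x^k / exp x at
  infinity; on the left the function is constantly zero.\<close>

lemma flat_fun_tendsto_0: "(flat_fun k \<longlongrightarrow> 0) (at 0)"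
proof (rule filterlim_split_at)
  show "(flat_fun k \<longlongrightarrow> 0) (at_left 0)"
    by (rule tendsto_eventually) (auto simp: eventually_at_filter flat_fun_def)
  have "((\<lambda>x::real. x ^ k / exp x) \<longlongrightarrow> 0) at_top"
    by (rule tendsto_power_div_exp_0)
  then have "((\<lambda>x::real. inverse x ^ k / exp (inverse x)) \<longlongrightarrow> 0) (at_right 0)"
    using filterlim_inverse_at_top_right by (rule filterlim_compose)
  then show "(flat_fun k \<longlongrightarrow> 0) (at_right 0)"
    by (rule Lim_transform_eventually)
      (auto simp: eventually_at_filter flat_fun_def exp_minus field_simps)
qed

lemma flat_fun_has_derivative:
  "(flat_fun k has_field_derivative flat_fun (k + 2) x - of_nat k * flat_fun (k + 1) x) (at x)"
proof (cases x "0 :: real" rule: linorder_cases)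
  case less
  have "((\<lambda>x::real. 0) has_field_derivative 0) (at x)"
    by simp
  then show ?thesis
    by (rule has_field_derivative_transform_within_open[where S = "{..<0}"
          and f = "\<lambda>x. 0", THEN DERIV_cong])
      (use less in \<open>auto simp: flat_fun_def\<close>)
next
  case equal
  \<comment> \<open>Dividing by h raises the exponent by one, so the difference quotient at 0 is
    \<open>flat_fun (Suc k)\<close>, which tends to 0. The claimed derivative is also 0 there, all
    members of the family vanishing at 0.\<close>
  have "((\<lambda>h. flat_fun k h / h) \<longlongrightarrow> 0) (at 0)"
    by (rule Lim_transform_eventually[OF flat_fun_tendsto_0[of "Suc k"]])
      (auto simp: eventually_at_filter flat_fun_def field_simps)
  then show ?thesis
    by (auto simp: DERIV_def equal flat_fun_def)
next
  case greater
  have "((\<lambda>x. exp (- inverse x) * inverse x ^ k) has_field_derivative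
      flat_fun (k + 2) x - of_nat k * flat_fun (k + 1) x) (at x)"
  proof -
    define y where "y = inverse x"
    have "(inverse has_field_derivative - (y ^ 2)) (at x)"
      using greater by (auto intro!: derivative_eq_intros simp: y_def power2_eq_square)
    then have "((\<lambda>x. exp (- inverse x) * inverse x ^ k) has_field_derivative
        exp (- y) * y ^ 2 * y ^ k - exp (- y) * (of_nat k * (y ^ (k - 1) * y ^ 2))) (at x)"
      using greater
      by (auto intro!: derivative_eq_intros simp: y_def power2_eq_square algebra_simps)
    \<comment> \<open>For k = 0 the truncated \<open>k - 1\<close> gives a wrong exponent, but then
      the factor \<open>of_nat k\<close> is zero.\<close>
    moreover have "of_nat k * (y ^ (k - 1) * y ^ 2) = of_nat k * y ^ (k + 1)"
      by (cases k) (simp_all add: power2_eq_square algebra_simps)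
    moreover have "flat_fun j x = exp (- y) * y ^ j" for j
      using greater by (simp add: flat_fun_def y_def)
    ultimately show ?thesis
      by (simp only:) (simp add: power2_eq_square algebra_simps)
  qed
  then show ?thesis
    by (rule has_field_derivative_transform_within_open[where S = "{0<..}"])
      (use greater in \<open>auto simp: flat_fun_def\<close>)
qed

lemma smooth_on_flat_fun: "smooth_on UNIV (flat_fun k)"
proof -
  have "Ck_on m UNIV (flat_fun k)" for m
  proof (induction m arbitrary: k)
    case 0
    show ?case
      using flat_fun_has_derivative
      by (auto intro!: continuous_at_imp_continuous_on DERIV_isCont)
  next
    case (Suc m)
    show ?case
    proof (rule Ck_on_SucI)
      show "(flat_fun k has_derivative
          (\<lambda>v. v *\<^sub>R flat_fun (k + 2) x + (- real k * v) *\<^sub>R flat_fun (k + 1) x)) (at x)" for x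
        using flat_fun_has_derivative[of k x]
        unfolding has_field_derivative_def
        by (rule has_derivative_eq_rhs) (auto simp: algebra_simps)
      show "Ck_on m UNIV (\<lambda>x. v *\<^sub>R flat_fun (k + 2) x + (- real k * v) *\<^sub>R flat_fun (k + 1) x)" for v
        using Suc by (intro Ck_on_add Ck_on_scaleR) auto
    qed auto
  qed
  then show ?thesis by (simp add: smooth_on_def)
qed

text \<open>Differentiating under the integral sign along the direction \<open>v\<close> reproduces an integral of the
  same shape with \<open>m\<close> raised by one, so the weight \<open>t ^ m\<close> is what the induction needs.\<close>

lemma integral_segment_has_derivative:
  fixes F :: "'a::euclidean_space \<Rightarrow> real"
  assumes S: "open S" "convex S" "a \<in> S" and F: "Ck_on (Suc 0) S F" and x: "x \<in> S"
  shows "((\<lambda>x. integral {0..1} (\<lambda>t. t ^ m * F (a + t *\<^sub>R (x - a)))) has_derivative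
    (\<lambda>v. integral {0..1} (\<lambda>t. t ^ Suc m * frechet_derivative F (at (a + t *\<^sub>R (x - a))) v))) (at x)"
proof -
  define D where "D = (\<lambda>x t v. t ^ Suc m * frechet_derivative F (at (a + t *\<^sub>R (x - a))) v)"
  have seg: "a + t *\<^sub>R (x - a) \<in> S" if "x \<in> S" "t \<in> {0..1}" for x and t :: real
    using convexD_alt[OF S(2,3) that(1), of t] that(2) by (simp add: algebra_simps)
  have FD: "(F has_derivative frechet_derivative F (at y)) (at y)" if "y \<in> S" for y
    using Ck_on_SucD(1)[OF F that] .
  have segc: "continuous_on (S \<times> cbox 0 1) (\<lambda>(x, t). a + t *\<^sub>R (x - a))" for S :: "'a set"
    by (auto simp: split_beta intro!: continuous_intros)
  have D: "((\<lambda>x. t ^ m * F (a + t *\<^sub>R (x - a))) has_derivative D x t) (at x within S)"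
    if "x \<in> S" "t \<in> cbox 0 1" for x t
  proof -
    have "((\<lambda>x. a + t *\<^sub>R (x - a)) has_derivative (\<lambda>v. t *\<^sub>R v)) (at x within S)"
      by (auto intro!: derivative_eq_intros)
    then have "((\<lambda>x. F (a + t *\<^sub>R (x - a))) has_derivative
        (\<lambda>v. frechet_derivative F (at (a + t *\<^sub>R (x - a))) (t *\<^sub>R v))) (at x within S)"
      by (rule has_derivative_compose) (rule FD[OF seg], use that in auto)
    then have "((\<lambda>x. t ^ m * F (a + t *\<^sub>R (x - a))) has_derivative
        (\<lambda>v. t ^ m * frechet_derivative F (at (a + t *\<^sub>R (x - a))) (t *\<^sub>R v))) (at x within S)"
      by (rule has_derivative_mult_right)
    moreover have "t ^ m * frechet_derivative F (at (a + t *\<^sub>R (x - a))) (t *\<^sub>R v) = D x t v" for v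
      using linear_scale[OF has_derivative_linear[OF FD[OF seg]]] that by (simp add: D_def)
    ultimately show ?thesis by simp
  qed
  have bl: "bounded_linear (D x t)" if "x \<in> S" "t \<in> cbox 0 1" for x t
    using D[OF that] by (rule has_derivative_bounded_linear)
  have cont: "continuous_on (S \<times> cbox 0 1) (\<lambda>(x, t). D x t v)" for v
  proof -
    have "continuous_on S (\<lambda>y. frechet_derivative F (at y) v)"
      using Ck_on_SucD(2)[OF F] by simp
    then have "continuous_on (S \<times> cbox 0 1)
        (\<lambda>p. frechet_derivative F (at ((\<lambda>(x, t). a + t *\<^sub>R (x - a)) p)) v)"
      using segc by (rule continuous_on_compose2) (use seg in auto)
    then show ?thesis
      by (auto simp: D_def split_beta intro!: continuous_intros)
  qed
  \<comment> \<open>\<open>leibniz_rule\<close> expects the derivative as a jointly continuous map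
    into bounded linear functions. In finite dimension this continuity can be checked one basis
    direction at a time, which is what \<open>cont\<close> provides.\<close>
  define B where "B = (\<lambda>x t. Blinfun (D x t))"
  have B: "blinfun_apply (B x t) = D x t" if "x \<in> S" "t \<in> cbox 0 1" for x t
    using bl[OF that] by (simp add: B_def bounded_linear_Blinfun_apply)
  have Bcont: "continuous_on (S \<times> cbox 0 1) (\<lambda>(x, t). B x t)"
  proof (rule continuous_on_blinfun_componentwise)
    fix i :: 'a
    show "continuous_on (S \<times> cbox 0 1) (\<lambda>p. blinfun_apply (case p of (x, t) \<Rightarrow> B x t) i)"
      using cont[of i] by (rule continuous_on_eq) (auto simp: B)
  qed
  have Fcont: "continuous_on S F"
    using Ck_on_less[OF F] by simp
  have int: "(\<lambda>t. t ^ m * F (a + t *\<^sub>R (x - a))) integrable_on cbox 0 1" if "x \<in> S" for x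
    by (intro integrable_continuous continuous_intros continuous_on_compose2[OF Fcont])
      (use seg that in auto)
  have "((\<lambda>x. integral (cbox 0 1) (\<lambda>t. t ^ m * F (a + t *\<^sub>R (x - a)))) has_derivative
      integral (cbox 0 1) (B x)) (at x within S)"
    using D B int Bcont x S(2) by (intro leibniz_rule) auto
  moreover have "blinfun_apply (integral (cbox 0 1) (B x)) = (\<lambda>v. integral (cbox 0 1) (\<lambda>t. D x t v))"
  proof
    fix v
    have "continuous_on (cbox 0 1) (B x)"
    proof -
      have "continuous_on (cbox 0 1) (\<lambda>t::real. (x, t))"
        by (intro continuous_on_Pair continuous_on_const continuous_on_id)
      from continuous_on_compose2[OF Bcont this] show ?thesis
        using x by auto
    qed
    then have "B x integrable_on cbox 0 1"
      by (rule integrable_continuous)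
    then have "blinfun_apply (integral (cbox 0 1) (B x)) v
        = integral (cbox 0 1) (\<lambda>t. blinfun_apply (B x t) v)"
      by (rule blinfun_apply_integral)
    also have "\<dots> = integral (cbox 0 1) (\<lambda>t. D x t v)"
      using x by (intro integral_cong) (simp add: B)
    finally show "blinfun_apply (integral (cbox 0 1) (B x)) v = integral (cbox 0 1) (\<lambda>t. D x t v)" .
  qed
  ultimately show ?thesis
    using x S(1) by (simp add: D_def at_within_open[of x S] del: power_Suc)
qed

lemma Ck_on_integral_segment:
  fixes F :: "'a::euclidean_space \<Rightarrow> real"
  assumes S: "open S" "convex S" "a \<in> S" and F: "Ck_on k S F"
  shows "Ck_on k S (\<lambda>x. integral {0..1} (\<lambda>t. t ^ m * F (a + t *\<^sub>R (x - a))))"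
  using F
proof (induction k arbitrary: F m)
  case 0
  have "a + t *\<^sub>R (x - a) \<in> S" if "x \<in> S" "t \<in> {0..1}" for x and t :: real
    using convexD_alt[OF S(2,3) that(1), of t] that(2) by (simp add: algebra_simps)
  then have "continuous_on (S \<times> cbox 0 1) (\<lambda>(x, t). t ^ m * F (a + t *\<^sub>R (x - a)))"
    using 0 by (auto simp: split_beta intro!: continuous_intros continuous_on_compose2[of S F])
  then show ?case
    using integral_continuous_on_param[of S 0 1 "\<lambda>x t. t ^ m * F (a + t *\<^sub>R (x - a))"] by simp
next
  case (Suc k)
  have "Ck_on (Suc 0) S F"
    using Suc.prems
  proof (induction k)
    case (Suc k)
    show ?case by (rule Suc.IH[OF Ck_on_less[OF Suc.prems]])
  qed
  then show ?case
    using integral_segment_has_derivative[OF S] Suc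
    by (intro Ck_on_SucI[OF S(1)]) (blast intro: Ck_on_SucD(2))+
qed

lemma smooth_on_integral_segment:
  fixes F :: "'a::euclidean_space \<Rightarrow> real"
  assumes "open S" "convex S" "a \<in> S" "smooth_on S F"
  shows "smooth_on S (\<lambda>x. integral {0..1} (\<lambda>t. F (a + t *\<^sub>R (x - a))))"
  using Ck_on_integral_segment[OF assms(1-3), of _ F 0] assms(4) by (simp add: smooth_on_def)

section \<open>Hadamard's lemma and Poincare's lemma for 1-forms\<close>

lemma frechet_derivative_axis_expansion:
  fixes F :: "real^'n \<Rightarrow> real"
  assumes "F differentiable (at x)"
  shows "frechet_derivative F (at x) v = (\<Sum>i\<in>UNIV. v $ i * frechet_derivative F (at x) (axis i 1))"
proof -
  have lin: "linear (frechet_derivative F (at x))"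
    using assms by (rule linear_frechet_derivative)
  have "frechet_derivative F (at x) v = frechet_derivative F (at x) (\<Sum>i\<in>UNIV. v $ i *\<^sub>R axis i 1)"
    by (simp add: basis_expansion flip: scalar_mult_eq_scaleR)
  then show ?thesis
    by (simp add: linear_sum[OF lin] linear_scale[OF lin])
qed

lemma has_real_derivative_segment:
  fixes F :: "real^'n \<Rightarrow> real"
  assumes "(F has_derivative F') (at (a + t *\<^sub>R v))"
  shows "((\<lambda>t. F (a + t *\<^sub>R v)) has_real_derivative F' v) (at t within T)"
proof -
  have "((\<lambda>t. a + t *\<^sub>R v) has_derivative (\<lambda>s. s *\<^sub>R v)) (at t within T)"
    by (auto intro!: derivative_eq_intros)
  from has_derivative_compose[OF this assms]
  show ?thesis
    unfolding has_field_derivative_def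
    by (rule has_derivative_eq_rhs)
      (auto simp: linear_scale[OF has_derivative_linear[OF assms]] fun_eq_iff)
qed

text \<open>Hadamard's lemma: \<open>h i x\<close> is the integral of \<open>\<partial>\<^sub>i F\<close> over the segment from \<open>a\<close> to \<open>x\<close>.\<close>

lemma smooth_on_first_order_expansion:
  fixes F :: "real^'n \<Rightarrow> real"
  assumes S: "open S" "convex S" "a \<in> S" and F: "smooth_on S F"
  obtains h where "\<And>i. smooth_on S (h i)"
    and "\<And>x. x \<in> S \<Longrightarrow> F x = F a + (\<Sum>i\<in>UNIV. (x $ i - a $ i) * h i x)"
    and "\<And>i. h i a = frechet_derivative F (at a) (axis i 1)"
proof
  let ?G = "\<lambda>i x. frechet_derivative F (at x) (axis i 1)"
  let ?h = "\<lambda>i x. integral {0..1} (\<lambda>t. ?G i (a + t *\<^sub>R (x - a)))"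
  have G: "smooth_on S (?G i)" for i
    by (rule smooth_on_frechet_derivative[OF F])
  then show "smooth_on S (?h i)" for i
    by (rule smooth_on_integral_segment[OF S])
  show "?h i a = ?G i a" for i
    by simp
  fix x assume x: "x \<in> S"
  have seg: "a + t *\<^sub>R (x - a) \<in> S" if "t \<in> {0..1}" for t :: real
    using convexD_alt[OF S(2,3) x, of t] that by (simp add: algebra_simps)
  have FD: "(F has_derivative frechet_derivative F (at (a + t *\<^sub>R (x - a)))) (at (a + t *\<^sub>R (x - a)))"
    if "t \<in> {0..1}" for t
    using smooth_on_has_derivative[OF F seg[OF that]] .
  have "((\<lambda>t. frechet_derivative F (at (a + t *\<^sub>R (x - a))) (x - a)) has_integral
      F (a + 1 *\<^sub>R (x - a)) - F (a + 0 *\<^sub>R (x - a))) {0..1}"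
    using has_real_derivative_segment[OF FD]
    by (intro fundamental_theorem_of_calculus)
      (auto simp flip: has_real_derivative_iff_has_vector_derivative)
  then have "F x - F a = integral {0..1} (\<lambda>t. frechet_derivative F (at (a + t *\<^sub>R (x - a))) (x - a))"
    by (simp add: integral_unique)
  also have "\<dots> = integral {0..1} (\<lambda>t. \<Sum>i\<in>UNIV. (x - a) $ i * ?G i (a + t *\<^sub>R (x - a)))"
    using FD by (intro integral_cong frechet_derivative_axis_expansion) (auto simp: differentiable_def)
  also have "\<dots> = (\<Sum>i\<in>UNIV. integral {0..1} (\<lambda>t. (x - a) $ i * ?G i (a + t *\<^sub>R (x - a))))"
  proof (rule integral_sum)
    fix i
    show "(\<lambda>t. (x - a) $ i * ?G i (a + t *\<^sub>R (x - a))) integrable_on {0..1}"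
      by (intro integrable_continuous_real continuous_intros
          continuous_on_compose2[OF smooth_on_imp_continuous_on[OF G]]) (use seg in auto)
  qed auto
  finally show "F x = F a + (\<Sum>i\<in>UNIV. (x $ i - a $ i) * ?h i x)"
    by simp
qed

text \<open>The potential is the line integral of the form over the segment from \<open>a\<close> to
  \<open>x\<close>. Differentiating it gives the wanted term plus an integral of derivatives of
  \<theta>; closedness moves the direction \<open>v\<close> out of that integral, and integration by
  parts evaluates what is left.\<close>

lemma Poincare_lemma_1_forms:
  fixes \<theta> :: "'n \<Rightarrow> real^'n \<Rightarrow> real"
  assumes S: "open S" "convex S" "a \<in> S" and \<theta>: "\<And>i. smooth_on S (\<theta> i)"
    and closed: "\<And>x i j. x \<in> S \<Longrightarrow>
      frechet_derivative (\<theta> i) (at x) (axis j 1) = frechet_derivative (\<theta> j) (at x) (axis i 1)"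
  obtains P where "smooth_on S P"
    and "\<And>x. x \<in> S \<Longrightarrow> (P has_derivative (\<lambda>v. \<Sum>i\<in>UNIV. v $ i * \<theta> i x)) (at x)"
proof
  let ?h = "\<lambda>i x. integral {0..1} (\<lambda>t. \<theta> i (a + t *\<^sub>R (x - a)))"
  let ?P = "\<lambda>x. \<Sum>i\<in>UNIV. (x $ i - a $ i) * ?h i x"
  show P: "(?P has_derivative (\<lambda>v. \<Sum>i\<in>UNIV. v $ i * \<theta> i x)) (at x)" if x: "x \<in> S" for x
  proof -
    let ?D = "\<lambda>i t. frechet_derivative (\<theta> i) (at (a + t *\<^sub>R (x - a)))"
    have seg: "a + t *\<^sub>R (x - a) \<in> S" if "t \<in> {0..1}" for t :: real
      using convexD_alt[OF S(2,3) x, of t] that by (simp add: algebra_simps)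
    have \<theta>D: "(\<theta> i has_derivative ?D i t) (at (a + t *\<^sub>R (x - a)))" if "t \<in> {0..1}" for t i
      using smooth_on_has_derivative[OF \<theta> seg[OF that]] .
    have cont: "continuous_on {0..1} (\<lambda>t. \<theta> i (a + t *\<^sub>R (x - a)))" for i
      by (rule continuous_on_compose2[OF smooth_on_imp_continuous_on[OF \<theta>]])
        (use seg in \<open>auto intro!: continuous_intros\<close>)
    have contD: "continuous_on {0..1} (\<lambda>t. t * ?D i t v)" for i v
      by (intro continuous_intros continuous_on_compose2[OF smooth_on_imp_continuous_on[OF
            smooth_on_frechet_derivative[OF \<theta>]]]) (use seg in auto)
    have h: "(?h i has_derivative (\<lambda>v. integral {0..1} (\<lambda>t. t * ?D i t v))) (at x)" for i
    proof -
      have "Ck_on (Suc 0) S (\<theta> i)"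
        using \<theta>[of i] unfolding smooth_on_def by blast
      from integral_segment_has_derivative[OF S this x, of 0] show ?thesis
        by simp
    qed
    \<comment> \<open>Integration by parts: the integrand together with \<open>\<theta> i\<close> is
      the t-derivative of t * \<theta> i at a + t(x - a), whose boundary values are
      \<open>\<theta> i x\<close> and 0.\<close>
    have parts: "integral {0..1} (\<lambda>t. t * ?D i t (x - a)) = \<theta> i x - ?h i x" for i
    proof -
      have "((\<lambda>t. t * \<theta> i (a + t *\<^sub>R (x - a))) has_vector_derivative
          \<theta> i (a + t *\<^sub>R (x - a)) + t * ?D i t (x - a)) (at t within {0..1})" if "t \<in> {0..1}" for t
        using has_real_derivative_segment[OF \<theta>D[OF that]]
        by (auto intro!: derivative_eq_intros simp flip: has_real_derivative_iff_has_vector_derivative)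
      then have "((\<lambda>t. \<theta> i (a + t *\<^sub>R (x - a)) + t * ?D i t (x - a)) has_integral
          1 * \<theta> i (a + 1 *\<^sub>R (x - a)) - 0 * \<theta> i (a + 0 *\<^sub>R (x - a))) {0..1}"
        by (intro fundamental_theorem_of_calculus) auto
      then have "integral {0..1} (\<lambda>t. \<theta> i (a + t *\<^sub>R (x - a)) + t * ?D i t (x - a)) = \<theta> i x"
        by (simp add: integral_unique)
      then show ?thesis
        using cont contD by (simp add: integral_add integrable_continuous_real)
    qed
    have "(\<Sum>i\<in>UNIV. (x $ i - a $ i) * integral {0..1} (\<lambda>t. t * ?D i t v))
        = (\<Sum>j\<in>UNIV. v $ j * integral {0..1} (\<lambda>t. t * ?D j t (x - a)))" for v
    proof -
      have "(\<Sum>i\<in>UNIV. (x - a) $ i * integral {0..1} (\<lambda>t. t * ?D i t v))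
          = integral {0..1} (\<lambda>t. \<Sum>i\<in>UNIV. (x - a) $ i * (t * ?D i t v))"
        by (subst integral_sum) (auto intro!: integrable_continuous_real continuous_on_mult_left contD)
      also have "\<dots> = integral {0..1} (\<lambda>t. \<Sum>j\<in>UNIV. v $ j * (t * ?D j t (x - a)))"
      proof (rule integral_cong)
        fix t :: real assume t: "t \<in> {0..1}"
        have exp: "?D i t w = (\<Sum>j\<in>UNIV. w $ j * ?D i t (axis j 1))" for i w
          using \<theta>D[OF t] by (intro frechet_derivative_axis_expansion) (auto simp: differentiable_def)
        have "(\<Sum>i\<in>UNIV. (x - a) $ i * ?D i t v) = (\<Sum>i\<in>UNIV. \<Sum>j\<in>UNIV. (x - a) $ i * (v $ j * ?D i t (axis j 1)))"
          by (subst exp) (simp add: sum_distrib_left)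
        \<comment> \<open>Closedness enters here: the matrix of partial derivatives is symmetric, so
          \<open>v\<close> and \<open>x - a\<close> trade places.\<close>
        also have "\<dots> = (\<Sum>j\<in>UNIV. \<Sum>i\<in>UNIV. v $ j * ((x - a) $ i * ?D j t (axis i 1)))"
          using closed[OF seg[OF t]] by (subst sum.swap) (simp add: mult.left_commute)
        also have "\<dots> = (\<Sum>j\<in>UNIV. v $ j * ?D j t (x - a))"
          by (subst (2) exp) (simp add: sum_distrib_left)
        finally show "(\<Sum>i\<in>UNIV. (x - a) $ i * (t * ?D i t v)) = (\<Sum>j\<in>UNIV. v $ j * (t * ?D j t (x - a)))"
          by (simp add: mult.left_commute[of _ t] flip: sum_distrib_left)
      qed
      also have "\<dots> = (\<Sum>j\<in>UNIV. v $ j * integral {0..1} (\<lambda>t. t * ?D j t (x - a)))"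
        by (subst integral_sum) (auto intro!: integrable_continuous_real continuous_on_mult_left contD)
      finally show ?thesis by simp
    qed
    moreover have "(?P has_derivative (\<lambda>v. \<Sum>i\<in>UNIV.
        (x $ i - a $ i) * integral {0..1} (\<lambda>t. t * ?D i t v) + v $ i * ?h i x)) (at x)"
    proof (intro has_derivative_sum has_derivative_mult h)
      show "((\<lambda>x. x $ i - a $ i) has_derivative (\<lambda>v. v $ i)) (at x)" for i
        using has_derivative_diff[OF bounded_linear_imp_has_derivative[OF bounded_linear_vec_nth]
            has_derivative_const[of "a $ i"]] by simp
    qed
    moreover have "(\<Sum>j\<in>UNIV. v $ j * integral {0..1} (\<lambda>t. t * ?D j t (x - a)))
        + (\<Sum>i\<in>UNIV. v $ i * ?h i x) = (\<Sum>i\<in>UNIV. v $ i * \<theta> i x)" for v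
      unfolding parts by (simp add: right_diff_distrib sum_subtractf)
    ultimately show ?thesis
      by (simp add: sum.distrib)
  qed
  show "smooth_on S ?P"
    by (rule smooth_onI[OF S(1) P]) (auto intro!: smooth_on_sum smooth_on_mult smooth_on_const S(1) \<theta>)
qed

section \<open>Cut-off functions on Euclidean space\<close>

lemma smooth_on_inverse: "smooth_on {0<..} (inverse :: real \<Rightarrow> real)"
proof -
  \<comment> \<open>Arbitrary \<open>c\<close> and \<open>n\<close> make the family closed under
    differentiation, which multiplies \<open>c\<close> by - n v and raises \<open>n\<close> by
    one.\<close>
  have "Ck_on k {0<..} (\<lambda>x::real. c * inverse x ^ n)" for k c n
  proof (induction k arbitrary: c n)
    case 0
    then show ?case by (auto intro!: continuous_intros)
  next
    case (Suc k)
    show ?case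
    proof (rule Ck_on_SucI[where f' = "\<lambda>x v. (- c * real n * v) * inverse x ^ Suc n"])
      show "((\<lambda>x::real. c * inverse x ^ n) has_derivative (\<lambda>v. (- c * real n * v) * inverse x ^ Suc n)) (at x)"
        if x: "x \<in> {0<..}" for x
      proof -
        have "((\<lambda>x::real. c * inverse x ^ n) has_field_derivative
            c * (real n * inverse x ^ (n - 1) * - (inverse x * inverse x))) (at x)"
          using x by (auto intro!: derivative_eq_intros)
        moreover have "c * (real n * inverse x ^ (n - 1) * - (inverse x * inverse x))
            = - c * real n * inverse x ^ Suc n"
          by (cases n) auto
        ultimately show ?thesis
          by (auto simp: has_field_derivative_def mult_ac elim!: has_derivative_eq_rhs)
      qed
      show "Ck_on k {0<..} (\<lambda>x::real. (- c * real n * v) * inverse x ^ Suc n)" for v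
        by (rule Suc)
    qed simp
  qed
  from this[of _ 1 1] show ?thesis by (simp add: smooth_on_def)
qed

text \<open>The usual quotient h(e^2 - s) / (h(e^2 - s) + h(s - e^2/4)) with h =
  \<open>flat_fun 0\<close>. The squared distance s is used since the distance itself is not smooth
  at \<open>a\<close>. The two arguments of h sum to 3e^2/4 > 0, so one of them is positive and the
  denominator never vanishes.\<close>

lemma smooth_bump_euclidean:
  fixes a :: "'a::euclidean_space"
  assumes "e > 0"
  obtains \<beta> :: "'a \<Rightarrow> real" where "smooth_on UNIV \<beta>" "\<And>x. x \<in> ball a (e / 2) \<Longrightarrow> \<beta> x = 1"
    "\<And>x. x \<notin> cball a e \<Longrightarrow> \<beta> x = 0"
proof
  let ?s = "\<lambda>x. (x - a) \<bullet> (x - a)"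
  let ?h = "flat_fun 0"
  let ?d = "\<lambda>x. ?h (e\<^sup>2 - ?s x) + ?h (?s x - e\<^sup>2 / 4)"
  let ?\<beta> = "\<lambda>x. ?h (e\<^sup>2 - ?s x) * inverse (?d x)"
  have sx: "?s x = (dist a x)\<^sup>2" for x
    by (metis dist_norm dist_commute power2_norm_eq_inner)
  have lin: "smooth_on UNIV (\<lambda>x. (x - a) \<bullet> b)" for b
    by (rule smooth_onI[where f' = "\<lambda>x v. v \<bullet> b"]) (auto intro!: derivative_eq_intros)
  have "smooth_on UNIV ?s"
    by (subst euclidean_inner) (intro smooth_on_sum smooth_on_mult lin open_UNIV)
  then have *: "smooth_on UNIV (\<lambda>x. c + d * ?s x)" for c d
    by (intro smooth_on_add smooth_on_mult smooth_on_const open_UNIV)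
  have h1: "smooth_on UNIV (\<lambda>x. ?h (e\<^sup>2 - ?s x))"
    using smooth_on_compose[OF open_UNIV smooth_on_flat_fun[of 0] *[of "e\<^sup>2" "-1"]] by simp
  have h2: "smooth_on UNIV (\<lambda>x. ?h (?s x - e\<^sup>2 / 4))"
    using smooth_on_compose[OF open_UNIV smooth_on_flat_fun[of 0] *[of "- e\<^sup>2 / 4" 1]]
    by (simp add: algebra_simps)
  have pos: "?d x > 0" for x
  proof -
    have "e\<^sup>2 > 0" using assms by simp
    then have "e\<^sup>2 - ?s x > 0 \<or> ?s x - e\<^sup>2 / 4 > 0" by linarith
    then show ?thesis
      by (auto simp: flat_fun_def add_pos_nonneg add_nonneg_pos)
  qed
  have "smooth_on UNIV (\<lambda>x. inverse (?d x))"
    by (rule smooth_on_compose[OF open_UNIV smooth_on_inverse smooth_on_add[OF open_UNIV h1 h2]])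
      (use pos in auto)
  then show "smooth_on UNIV ?\<beta>"
    by (intro smooth_on_mult h1 open_UNIV)
  show "?\<beta> x = 1" if "x \<in> ball a (e / 2)" for x
  proof -
    have "(dist a x)\<^sup>2 \<le> (e / 2)\<^sup>2"
      using that by (intro power_mono) auto
    then have "?h (?s x - e\<^sup>2 / 4) = 0"
      unfolding sx by (simp add: flat_fun_def power2_eq_square)
    then show ?thesis using pos[of x] by simp
  qed
  show "?\<beta> x = 0" if "x \<notin> cball a e" for x
  proof -
    have "e\<^sup>2 \<le> (dist a x)\<^sup>2"
      using that assms by (intro power_mono) auto
    then show ?thesis
      unfolding sx by (simp add: flat_fun_def)
  qed
qed

section \<open>Smooth functions and bump functions on a manifold\<close>

context smooth_manifold
begin

lemma chart_inj: "(U, \<phi>) \<in> A \<Longrightarrow> inj_on \<phi> U"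
  using homeomorphic_imp_injective_map[OF chart_homeo] openin_subset[OF chart_domain]
  by (metis topspace_subtopology_subset)

lemma chart_subset: "(U, \<phi>) \<in> A \<Longrightarrow> U \<subseteq> topspace M"
  using openin_subset[OF chart_domain] .

lemma chart_inv: "(U, \<phi>) \<in> A \<Longrightarrow> q \<in> U \<Longrightarrow> inv_into U \<phi> (\<phi> q) = q"
  using chart_inj by (simp add: inv_into_f_f)

lemma open_chart_image:
  assumes "(U, \<phi>) \<in> A" "openin M W" "W \<subseteq> U"
  shows "open (\<phi> ` W)"
proof -
  have "openin (subtopology M U) W"
    using assms(2,3) chart_domain[OF assms(1)] by (simp add: openin_open_subtopology)
  then have "openin (top_of_set (\<phi> ` U)) (\<phi> ` W)"
    using homeomorphic_imp_open_map[OF chart_homeo[OF assms(1)]] by (simp add: open_map_def)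
  then show ?thesis
    using chart_range[OF assms(1)] openin_open_eq by blast
qed

lemma openin_chart_preimage:
  assumes "(U, \<phi>) \<in> A" "open B"
  shows "openin M {q \<in> U. \<phi> q \<in> B}"
proof -
  have "openin (subtopology M U) {q \<in> topspace (subtopology M U). \<phi> q \<in> \<phi> ` U \<inter> B}"
    by (rule openin_continuous_map_preimage[OF homeomorphic_imp_continuous_map[OF
          chart_homeo[OF assms(1)]] openin_open_Int[OF assms(2)]])
  moreover have "{q \<in> topspace (subtopology M U). \<phi> q \<in> \<phi> ` U \<inter> B} = {q \<in> U. \<phi> q \<in> B}"
    using chart_subset[OF assms(1)] by auto
  ultimately show ?thesis
    using chart_domain[OF assms(1)] by (simp add: openin_open_subtopology)
qed

text \<open>A set that is closed in \<open>U\<close> need not be closed in M. Compactness survives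
  the passage through the chart, and in a Hausdorff space it yields closedness in the whole of M.
  This is what allows functions supported in a chart to be extended by zero.\<close>

lemma closedin_chart_preimage:
  assumes "(U, \<phi>) \<in> A" "compact B" "B \<subseteq> \<phi> ` U"
  shows "closedin M {q \<in> U. \<phi> q \<in> B}"
proof -
  let ?K = "{q \<in> U. \<phi> q \<in> B}"
  have "\<phi> ` ?K = B" using assms(3) by auto
  then have "compactin (top_of_set (\<phi> ` U)) (\<phi> ` ?K)"
    using assms(2,3) by (simp add: compactin_subtopology)
  then have "compactin (subtopology M U) ?K"
    using homeomorphic_map_compactness[OF chart_homeo[OF assms(1)], of ?K] chart_subset[OF assms(1)]
    by auto
  then have "compactin M ?K"
    by (simp add: compactin_subtopology)
  then show ?thesis
    using hausdorff compactin_imp_closedin by blast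
qed

lemma smooth_fun_on_openin: "smooth_fun_on W f \<Longrightarrow> openin M W"
  by (simp add: smooth_fun_on_def)

lemma smooth_fun_onD:
  "smooth_fun_on W f \<Longrightarrow> (U, \<phi>) \<in> A \<Longrightarrow> smooth_on (\<phi> ` (U \<inter> W)) (\<lambda>x. f (inv_into U \<phi> x))"
  by (fastforce simp: smooth_fun_on_def comp_def)

lemma smooth_fun_onI:
  "openin M W \<Longrightarrow> (\<And>U \<phi>. (U, \<phi>) \<in> A \<Longrightarrow> smooth_on (\<phi> ` (U \<inter> W)) (\<lambda>x. f (inv_into U \<phi> x)))
    \<Longrightarrow> smooth_fun_on W f"
  by (auto simp: smooth_fun_on_def comp_def)

lemma open_chart_image_Int: "openin M W \<Longrightarrow> (U, \<phi>) \<in> A \<Longrightarrow> open (\<phi> ` (U \<inter> W))"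
  by (intro open_chart_image) (auto intro: chart_domain)

lemma smooth_fun_on_subset:
  assumes "smooth_fun_on W f" "openin M V" "V \<subseteq> W"
  shows "smooth_fun_on V f"
proof (rule smooth_fun_onI[OF assms(2)])
  fix U \<phi> assume "(U, \<phi>) \<in> A"
  from smooth_fun_onD[OF assms(1) this] show "smooth_on (\<phi> ` (U \<inter> V)) (\<lambda>x. f (inv_into U \<phi> x))"
    by (rule smooth_on_subset) (use assms(3) in auto)
qed

lemma smooth_fun_on_cong:
  assumes "smooth_fun_on W f" "\<And>q. q \<in> W \<Longrightarrow> f q = f' q"
  shows "smooth_fun_on W f'"
proof (rule smooth_fun_onI[OF smooth_fun_on_openin[OF assms(1)]])
  fix U \<phi> assume U: "(U, \<phi>) \<in> A"
  show "smooth_on (\<phi> ` (U \<inter> W)) (\<lambda>x. f' (inv_into U \<phi> x))"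
    using smooth_fun_onD[OF assms(1) U] open_chart_image_Int[OF smooth_fun_on_openin[OF assms(1)] U]
    by (rule smooth_on_cong[THEN iffD1, rotated 2]) (use assms(2) chart_inv[OF U] in auto)
qed

text \<open>In a chart, the images of all the open sets on which \<open>f\<close> is smooth form an
  open cover of the image of \<open>W\<close>, and smoothness passes to unions of open sets.\<close>

lemma smooth_fun_on_local:
  assumes "openin M W" "\<And>q. q \<in> W \<Longrightarrow> smooth_near q f"
  shows "smooth_fun_on W f"
proof (rule smooth_fun_onI[OF assms(1)])
  fix U \<phi> assume U: "(U, \<phi>) \<in> A"
  let ?T = "{\<phi> ` (U \<inter> V) | V. smooth_fun_on V f}"
  have "smooth_on (\<Union>?T) (\<lambda>x. f (inv_into U \<phi> x))"
    using open_chart_image_Int[OF smooth_fun_on_openin U] smooth_fun_onD[OF _ U]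
    by (intro smooth_on_Union) auto
  then show "smooth_on (\<phi> ` (U \<inter> W)) (\<lambda>x. f (inv_into U \<phi> x))"
  proof (rule smooth_on_subset)
    show "\<phi> ` (U \<inter> W) \<subseteq> \<Union>?T"
    proof
      fix y assume "y \<in> \<phi> ` (U \<inter> W)"
      then obtain q where q: "q \<in> U" "q \<in> W" "y = \<phi> q" by blast
      then obtain V where "q \<in> V" "smooth_fun_on V f"
        using assms(2) by (auto simp: smooth_near_def)
      then show "y \<in> \<Union>?T" using q by blast
    qed
  qed
qed

lemma smooth_fun_on_const: "openin M W \<Longrightarrow> smooth_fun_on W (\<lambda>q. c)"
  by (rule smooth_fun_onI) auto

lemma smooth_fun_on_add:
  assumes "smooth_fun_on W f" "smooth_fun_on W h"
  shows "smooth_fun_on W (\<lambda>q. f q + h q)"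
  using smooth_fun_on_openin[OF assms(1)]
  by (rule smooth_fun_onI)
    (intro smooth_on_add smooth_fun_onD[OF assms(1)] smooth_fun_onD[OF assms(2)]
      open_chart_image_Int[OF smooth_fun_on_openin[OF assms(1)]])

lemma smooth_fun_on_mult:
  assumes "smooth_fun_on W f" "smooth_fun_on W h"
  shows "smooth_fun_on W (\<lambda>q. f q * h q)"
  using smooth_fun_on_openin[OF assms(1)]
  by (rule smooth_fun_onI)
    (intro smooth_on_mult smooth_fun_onD[OF assms(1)] smooth_fun_onD[OF assms(2)]
      open_chart_image_Int[OF smooth_fun_on_openin[OF assms(1)]])

lemma smooth_fun_on_sum:
  assumes "openin M W" "\<And>i. i \<in> I \<Longrightarrow> smooth_fun_on W (f i)"
  shows "smooth_fun_on W (\<lambda>q. \<Sum>i\<in>I. f i q)"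
  using assms(2)
  by (induction I rule: infinite_finite_induct) (auto intro: smooth_fun_on_const assms(1) smooth_fun_on_add)

lemma smooth_fun_on_prod:
  assumes "openin M W" "\<And>i. i \<in> I \<Longrightarrow> smooth_fun_on W (f i)"
  shows "smooth_fun_on W (\<lambda>q. \<Prod>i\<in>I. f i q)"
  using assms(2)
  by (induction I rule: infinite_finite_induct) (auto intro: smooth_fun_on_const assms(1) smooth_fun_on_mult)

lemma smooth_fun_on_compose:
  assumes "smooth_fun_on W f" "smooth_on UNIV h"
  shows "smooth_fun_on W (\<lambda>q. h (f q))"
  by (rule smooth_fun_onI[OF smooth_fun_on_openin[OF assms(1)]], rule smooth_on_compose[OF _ assms(2)])
    (auto intro: smooth_fun_onD[OF assms(1)] open_chart_image_Int[OF smooth_fun_on_openin[OF assms(1)]])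

text \<open>Seen in another chart the function is \<open>F\<close> composed with a transition map.
  This is where the compatibility of the charts enters: smoothness may be tested in a single
  chart.\<close>

lemma smooth_fun_on_chart:
  assumes U: "(U, \<phi>) \<in> A" and W: "openin M W" "W \<subseteq> U" and F: "smooth_on (\<phi> ` W) F"
  shows "smooth_fun_on W (\<lambda>q. F (\<phi> q))"
proof (rule smooth_fun_onI[OF W(1)])
  fix V \<psi> assume V: "(V, \<psi>) \<in> A"
  have "smooth_on (\<psi> ` (V \<inter> W)) (\<lambda>x. \<phi> (inv_into V \<psi> x))"
    by (rule smooth_on_subset[OF transition_smooth[OF V U, unfolded comp_def]]) (use W(2) in auto)
  then show "smooth_on (\<psi> ` (V \<inter> W)) (\<lambda>x. F (\<phi> (inv_into V \<psi> x)))"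
    by (rule smooth_on_compose[OF open_chart_image_Int[OF W(1) V] F])
      (auto simp: chart_inv[OF V])
qed

lemma smooth_fun_on_coordinate:
  assumes "(U, \<phi>) \<in> A"
  shows "smooth_fun_on U (\<lambda>q. \<phi> q $ i)"
  by (rule smooth_fun_on_chart[OF assms chart_domain[OF assms] order_refl])
    (rule smooth_on_linear[OF chart_range[OF assms] bounded_linear_vec_nth])

text \<open>The open sets \<open>W\<close> and \<open>topspace M - K\<close> cover M; on the first
  \<open>F\<close> is \<open>f\<close>, on the second it is zero.\<close>

lemma smooth_fun_on_extend_zero:
  assumes f: "smooth_fun_on W f" and K: "closedin M K" "K \<subseteq> W"
    and F: "\<And>q. q \<in> W \<Longrightarrow> F q = f q" "\<And>q. q \<in> topspace M - K \<Longrightarrow> F q = 0"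
  shows "smooth_fun_on (topspace M) F"
proof (rule smooth_fun_on_local[OF openin_topspace])
  fix q assume q: "q \<in> topspace M"
  show "smooth_near q F"
  proof (cases "q \<in> W")
    case True
    have "smooth_fun_on W F"
      by (rule smooth_fun_on_cong[OF f]) (simp add: F(1))
    with True show ?thesis unfolding smooth_near_def by blast
  next
    case False
    have "smooth_fun_on (topspace M - K) F"
      by (rule smooth_fun_on_cong[OF smooth_fun_on_const[of "topspace M - K" 0]])
        (simp_all add: F(2) openin_diff[OF openin_topspace K(1)])
    moreover have "q \<in> topspace M - K"
      using False K(2) q by blast
    ultimately show ?thesis
      unfolding smooth_near_def by blast
  qed
qed

lemma chart_at:
  assumes "p \<in> topspace M"
  obtains U \<phi> where "(U, \<phi>) \<in> A" "p \<in> U"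
  using assms charts_cover by blast

text \<open>Two sets are recorded because they serve different ends: on the open plateau
  \<open>N\<close> multiplication by \<eta> changes nothing, and the closed set \<open>K\<close>
  inside \<open>W\<close> permits extension by zero from \<open>W\<close>.\<close>

lemma smooth_bump:
  assumes W: "openin M W" "p \<in> W"
  obtains \<eta> N K where "smooth_fun_on (topspace M) \<eta>" "openin M N" "p \<in> N" "N \<subseteq> K" "closedin M K" "K \<subseteq> W"
    "\<And>q. q \<in> N \<Longrightarrow> \<eta> q = 1" "\<And>q. q \<notin> K \<Longrightarrow> \<eta> q = 0"
proof -
  obtain U \<phi> where U: "(U, \<phi>) \<in> A" "p \<in> U"
    using W openin_subset chart_at by blast
  have "open (\<phi> ` (U \<inter> W))"
    by (rule open_chart_image_Int[OF W(1) U(1)])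
  then obtain e where e: "e > 0" "cball (\<phi> p) e \<subseteq> \<phi> ` (U \<inter> W)"
    using U(2) W(2) open_contains_cball by blast
  obtain \<beta> :: "real^'n \<Rightarrow> real" where \<beta>: "smooth_on UNIV \<beta>"
    "\<And>x. x \<in> ball (\<phi> p) (e / 2) \<Longrightarrow> \<beta> x = 1" "\<And>x. x \<notin> cball (\<phi> p) e \<Longrightarrow> \<beta> x = 0"
    using smooth_bump_euclidean[OF e(1)] by metis
  define \<eta> where "\<eta> q = (if q \<in> U then \<beta> (\<phi> q) else 0)" for q
  let ?N = "{q \<in> U. \<phi> q \<in> ball (\<phi> p) (e / 2)}" and ?K = "{q \<in> U. \<phi> q \<in> cball (\<phi> p) e}"
  have K: "closedin M ?K"
    using e(2) by (intro closedin_chart_preimage[OF U(1)]) auto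
  have "smooth_fun_on U (\<lambda>q. \<beta> (\<phi> q))"
    by (rule smooth_fun_on_chart[OF U(1) chart_domain[OF U(1)]]) (auto intro: smooth_on_subset[OF \<beta>(1)])
  then have "smooth_fun_on (topspace M) \<eta>"
    using K by (rule smooth_fun_on_extend_zero) (auto simp: \<eta>_def \<beta>(3))
  \<comment> \<open>A point of \<open>?K\<close> only has the same coordinates as some point of
    \<open>U \<inter> W\<close>; injectivity of the chart identifies the two.\<close>
  moreover have "?K \<subseteq> W"
    using e(2) inj_onD[OF chart_inj[OF U(1)]] by blast
  ultimately show thesis
    using openin_chart_preimage[OF U(1) open_ball[of "\<phi> p" "e / 2"]] U(2) e(1) K \<beta>(2,3)
    by (intro that[of \<eta> ?N ?K]) (auto simp: \<eta>_def)
qed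

end

section \<open>Tangent vectors in coordinates\<close>

text \<open>The coordinate functions are taken on the whole type. Their values outside the chart
  domain are arbitrary but harmless, since a tangent vector at a point of the domain sees only
  germs.\<close>

definition coord_vec :: "('m \<Rightarrow> real^'n) \<Rightarrow> 'm tangent \<Rightarrow> real^'n"
  where "coord_vec \<phi> v = (\<chi> i. v (\<lambda>q. \<phi> q $ i))"

lemma coord_vec_add: "coord_vec \<phi> (u + v) = coord_vec \<phi> u + coord_vec \<phi> v"
  and coord_vec_scaleR: "coord_vec \<phi> (c *\<^sub>R v) = c *\<^sub>R coord_vec \<phi> v"
  and coord_vec_zero: "coord_vec \<phi> 0 = 0"
  and coord_vec_diff: "coord_vec \<phi> (u - v) = coord_vec \<phi> u - coord_vec \<phi> v"
  by (simp_all add: coord_vec_def vec_eq_iff scaleR_fun_def)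

lemma linear_coord_vec: "linear (coord_vec \<phi>)"
  by (simp add: linearI coord_vec_add coord_vec_scaleR)

lemma coord_vec_sum: "coord_vec \<phi> (\<Sum>i\<in>I. f i) = (\<Sum>i\<in>I. coord_vec \<phi> (f i))"
  using linear_sum[OF linear_coord_vec] .

context smooth_manifold
begin

text \<open>The directional derivative along \<open>w\<close> in the chart; on the tangent space at
  \<open>q\<close> it is inverse to \<open>coord_vec\<close>. The value 0 off the smooth germs
  follows the convention built into \<open>tangent_space\<close>.\<close>

definition tangent_of :: "'m set \<Rightarrow> ('m \<Rightarrow> real^'n) \<Rightarrow> 'm \<Rightarrow> real^'n \<Rightarrow> 'm tangent"
  where "tangent_of U \<phi> q w = (\<lambda>f. if smooth_near q f
    then frechet_derivative (\<lambda>x. f (inv_into U \<phi> x)) (at (\<phi> q)) w else 0)"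

lemma smooth_nearI: "smooth_fun_on W f \<Longrightarrow> q \<in> W \<Longrightarrow> smooth_near q f"
  by (auto simp: smooth_near_def)

lemma smooth_near_cong:
  assumes "smooth_near q f" "openin M W" "q \<in> W" "\<And>r. r \<in> W \<Longrightarrow> f r = f' r"
  shows "smooth_near q f'"
proof -
  obtain V where V: "q \<in> V" "smooth_fun_on V f"
    using assms(1) by (auto simp: smooth_near_def)
  have "smooth_fun_on (V \<inter> W) f"
    using V assms(2) smooth_fun_on_openin[OF V(2)]
    by (intro smooth_fun_on_subset[OF V(2)]) auto
  then have "smooth_fun_on (V \<inter> W) f'"
    by (rule smooth_fun_on_cong) (use assms(4) in auto)
  then show ?thesis
    using V(1) assms(3) by (auto intro: smooth_nearI)
qed

lemma smooth_near_common:
  assumes "smooth_near q f" "smooth_near q h"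
  obtains W where "q \<in> W" "smooth_fun_on W f" "smooth_fun_on W h"
proof -
  obtain V W where VW: "q \<in> V" "smooth_fun_on V f" "q \<in> W" "smooth_fun_on W h"
    using assms by (auto simp: smooth_near_def)
  then have "openin M (V \<inter> W)"
    by (auto dest: smooth_fun_on_openin)
  then show thesis
    using VW by (intro that[of "V \<inter> W"]) (auto intro: smooth_fun_on_subset)
qed

lemma smooth_near_add:
  assumes "smooth_near q f" "smooth_near q h"
  shows "smooth_near q (\<lambda>r. f r + h r)"
  by (rule smooth_near_common[OF assms]) (blast intro: smooth_nearI smooth_fun_on_add)

lemma smooth_near_mult:
  assumes "smooth_near q f" "smooth_near q h"
  shows "smooth_near q (\<lambda>r. f r * h r)"
  by (rule smooth_near_common[OF assms]) (blast intro: smooth_nearI smooth_fun_on_mult)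

lemma smooth_near_const: "q \<in> topspace M \<Longrightarrow> smooth_near q (\<lambda>r. c)"
  using smooth_fun_on_const[OF openin_topspace] by (rule smooth_nearI)

lemma smooth_near_chart:
  assumes "smooth_near q f" "(U, \<phi>) \<in> A" "q \<in> U"
  obtains e where "e > 0" "ball (\<phi> q) e \<subseteq> \<phi> ` U" "smooth_on (ball (\<phi> q) e) (\<lambda>x. f (inv_into U \<phi> x))"
proof -
  obtain W where W: "q \<in> W" "smooth_fun_on W f"
    using assms(1) by (auto simp: smooth_near_def)
  have "open (\<phi> ` (U \<inter> W))" "\<phi> q \<in> \<phi> ` (U \<inter> W)"
    using open_chart_image_Int[OF smooth_fun_on_openin[OF W(2)] assms(2)] W(1) assms(3) by auto
  then obtain e where e: "e > 0" "ball (\<phi> q) e \<subseteq> \<phi> ` (U \<inter> W)"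
    using open_contains_ball by blast
  show thesis
    by (rule that[OF e(1) _ smooth_on_subset[OF smooth_fun_onD[OF W(2) assms(2)] e(2)]])
      (use e(2) in auto)
qed

lemma smooth_near_has_derivative:
  assumes "smooth_near q f" "(U, \<phi>) \<in> A" "q \<in> U"
  shows "((\<lambda>x. f (inv_into U \<phi> x)) has_derivative
    frechet_derivative (\<lambda>x. f (inv_into U \<phi> x)) (at (\<phi> q))) (at (\<phi> q))"
  by (rule smooth_near_chart[OF assms]) (simp add: smooth_on_has_derivative)

lemma tangent_ofI:
  assumes "smooth_near q f" "((\<lambda>x. f (inv_into U \<phi> x)) has_derivative D) (at (\<phi> q))"
  shows "tangent_of U \<phi> q w f = D w"
  using assms(1) frechet_derivative_at[OF assms(2)] by (simp add: tangent_of_def)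

lemma tangent_of_in_tangent_space:
  assumes "(U, \<phi>) \<in> A" "q \<in> U"
  shows "tangent_of U \<phi> q w \<in> tangent_space q"
proof -
  note D = smooth_near_has_derivative[OF _ assms]
  have q: "q \<in> topspace M"
    using assms chart_subset by blast
  have inv: "inv_into U \<phi> (\<phi> q) = q"
    using chart_inv assms by blast
  have "tangent_of U \<phi> q w (f + h) = tangent_of U \<phi> q w f + tangent_of U \<phi> q w h"
    if "smooth_near q f" "smooth_near q h" for f h
    using tangent_ofI[OF smooth_near_add[OF that] has_derivative_add[OF D[OF that(1)] D[OF that(2)]]] that
    by (simp add: plus_fun_def tangent_of_def)
  moreover have "tangent_of U \<phi> q w (f * h) = f q * tangent_of U \<phi> q w h + h q * tangent_of U \<phi> q w f"
    if "smooth_near q f" "smooth_near q h" for f h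
    using tangent_ofI[OF smooth_near_mult[OF that] has_derivative_mult[OF D[OF that(1)] D[OF that(2)]]] that
    by (simp add: times_fun_def tangent_of_def inv mult.commute)
  moreover have "tangent_of U \<phi> q w (c *\<^sub>R f) = c * tangent_of U \<phi> q w f" if "smooth_near q f" for c f
  proof -
    have "((\<lambda>x. c * f (inv_into U \<phi> x)) has_derivative
        (\<lambda>w. c * frechet_derivative (\<lambda>x. f (inv_into U \<phi> x)) (at (\<phi> q)) w)) (at (\<phi> q))"
      by (rule has_derivative_mult_right[OF D[OF that]])
    from tangent_ofI[OF smooth_near_mult[OF smooth_near_const[OF q] that] this] show ?thesis
      using that by (simp add: scaleR_fun_def tangent_of_def)
  qed
  ultimately show ?thesis
    by (simp add: tangent_space_def) (simp add: tangent_of_def)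
qed

lemma tangent_add:
  "v \<in> tangent_space q \<Longrightarrow> smooth_near q f \<Longrightarrow> smooth_near q h \<Longrightarrow> v (\<lambda>r. f r + h r) = v f + v h"
  by (simp add: tangent_space_def plus_fun_def)

lemma tangent_mult:
  "v \<in> tangent_space q \<Longrightarrow> smooth_near q f \<Longrightarrow> smooth_near q h \<Longrightarrow>
    v (\<lambda>r. f r * h r) = f q * v h + h q * v f"
  by (simp add: tangent_space_def times_fun_def)

lemma tangent_scale:
  "v \<in> tangent_space q \<Longrightarrow> smooth_near q f \<Longrightarrow> v (\<lambda>r. c * f r) = c * v f"
  by (simp add: tangent_space_def scaleR_fun_def)

lemma tangent_not_smooth: "v \<in> tangent_space q \<Longrightarrow> \<not> smooth_near q f \<Longrightarrow> v f = 0"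
  by (simp add: tangent_space_def)

text \<open>The Leibniz rule for 1 = 1 * 1 gives v 1 = 2 * v 1, hence v 1 = 0.\<close>

lemma tangent_const:
  assumes "v \<in> tangent_space q" "q \<in> topspace M"
  shows "v (\<lambda>r. c) = 0"
proof -
  have "v (\<lambda>r. 1 * 1) = 1 * v (\<lambda>r. 1) + 1 * v (\<lambda>r. 1)"
    using assms by (intro tangent_mult smooth_near_const)
  then have "v (\<lambda>r. 1) = 0" by simp
  then show ?thesis
    using tangent_scale[OF assms(1) smooth_near_const[OF assms(2), of 1], of c] by simp
qed

lemma tangent_diff:
  assumes "v \<in> tangent_space q" "smooth_near q f" "smooth_near q h"
  shows "v (\<lambda>r. f r - h r) = v f - v h"
proof -
  have q: "q \<in> topspace M"
    using assms(2) smooth_fun_on_openin openin_subset by (fastforce simp: smooth_near_def)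
  have "smooth_near q (\<lambda>r. - 1 * h r)"
    by (intro smooth_near_mult smooth_near_const q assms)
  then have "v (\<lambda>r. f r + - 1 * h r) = v f + - 1 * v h"
    by (simp only: tangent_add[OF assms(1,2)] tangent_scale[OF assms(1,3)])
  then show ?thesis by simp
qed

lemma tangent_sum:
  assumes "v \<in> tangent_space q" "q \<in> topspace M" "\<And>i. i \<in> I \<Longrightarrow> smooth_near q (f i)"
  shows "v (\<lambda>r. \<Sum>i\<in>I. f i r) = (\<Sum>i\<in>I. v (f i)) \<and> smooth_near q (\<lambda>r. \<Sum>i\<in>I. f i r)"
  using assms(3)
proof (induction I rule: infinite_finite_induct)
  case (insert i I)
  then show ?case
    using tangent_add[OF assms(1), of "f i"] smooth_near_add[of q "f i"] by simp
qed (use tangent_const smooth_near_const assms in auto)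

text \<open>A function vanishing near \<open>q\<close> is its own product with the indicator function of the
  complement of a neighbourhood of \<open>q\<close>, so the Leibniz rule kills it.\<close>

lemma tangent_local:
  assumes v: "v \<in> tangent_space q" and W: "openin M W" "q \<in> W" "\<And>r. r \<in> W \<Longrightarrow> f r = f' r"
  shows "v f = v f'"
proof (cases "smooth_near q f")
  case True
  then have f': "smooth_near q f'"
    using W by (rule smooth_near_cong)
  have q: "q \<in> topspace M"
    using W openin_subset by blast
  define d where "d r = f r - f' r" for r
  define \<iota> where "\<iota> r = (if r \<in> W then 0 else 1 :: real)" for r
  have d: "smooth_near q d" and \<iota>: "smooth_near q \<iota>"
    by (rule smooth_near_cong[OF smooth_near_const[OF q, of 0] W(1,2)]; simp add: d_def \<iota>_def W(3))+
  have "d = (\<lambda>r. d r * \<iota> r)"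
    by (auto simp: d_def \<iota>_def W(3))
  then have "v d = d q * v \<iota> + \<iota> q * v d"
    using tangent_mult[OF v d \<iota>] by simp
  then have "v d = 0"
    by (simp add: d_def \<iota>_def W)
  then show ?thesis
    using tangent_diff[OF v True f'] by (simp add: d_def[abs_def])
next
  case False
  then have "\<not> smooth_near q f'"
    using smooth_near_cong[OF _ W(1,2), of f' f] W(3) by metis
  then show ?thesis
    using False tangent_not_smooth[OF v] by simp
qed

lemma smooth_near_coordinate: "(U, \<phi>) \<in> A \<Longrightarrow> q \<in> U \<Longrightarrow> smooth_near q (\<lambda>r. \<phi> r $ i)"
  using smooth_fun_on_coordinate by (blast intro: smooth_nearI)

lemma coord_vec_tangent_of:
  assumes "(U, \<phi>) \<in> A" "q \<in> U"
  shows "coord_vec \<phi> (tangent_of U \<phi> q w) = w"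
proof -
  have "((\<lambda>x. \<phi> (inv_into U \<phi> x) $ i) has_derivative (\<lambda>w. w $ i)) (at (\<phi> q))" for i
    by (rule has_derivative_transform_within_open[OF
          bounded_linear_imp_has_derivative[OF bounded_linear_vec_nth] chart_range[OF assms(1)]])
      (use assms(2) in \<open>auto simp: f_inv_into_f\<close>)
  from tangent_ofI[OF smooth_near_coordinate[OF assms] this]
  show ?thesis
    by (simp add: coord_vec_def vec_eq_iff)
qed

text \<open>Derivations are directional derivatives. Hadamard's lemma writes \<open>f\<close> near
  \<open>q\<close> as a constant plus products of x_i - x_i(q) with smooth h_i. The first factors
  vanish at \<open>q\<close>, so the Leibniz rule leaves only v(x_i) h_i(q), and h_i(q) is the i-th
  partial derivative.\<close>

lemma tangent_of_coord_vec:
  assumes U: "(U, \<phi>) \<in> A" "q \<in> U" and v: "v \<in> tangent_space q"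
  shows "tangent_of U \<phi> q (coord_vec \<phi> v) = v"
proof
  fix f
  have q: "q \<in> topspace M"
    using U chart_subset by blast
  show "tangent_of U \<phi> q (coord_vec \<phi> v) f = v f"
  proof (cases "smooth_near q f")
    case True
    let ?F = "\<lambda>x. f (inv_into U \<phi> x)"
    obtain e where e: "e > 0" "ball (\<phi> q) e \<subseteq> \<phi> ` U" "smooth_on (ball (\<phi> q) e) ?F"
      using smooth_near_chart[OF True U] .
    obtain h where h: "\<And>i. smooth_on (ball (\<phi> q) e) (h i)"
      "\<And>x. x \<in> ball (\<phi> q) e \<Longrightarrow> ?F x = ?F (\<phi> q) + (\<Sum>i\<in>UNIV. (x $ i - \<phi> q $ i) * h i x)"
      "\<And>i. h i (\<phi> q) = frechet_derivative ?F (at (\<phi> q)) (axis i 1)"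
      by (rule smooth_on_first_order_expansion[OF open_ball convex_ball
            centre_in_ball[THEN iffD2, OF e(1)] e(3)]) blast
    let ?W = "{r \<in> U. \<phi> r \<in> ball (\<phi> q) e}"
    have W: "openin M ?W" "q \<in> ?W"
      using openin_chart_preimage[OF U(1) open_ball] U(2) e(1) by auto
    have "\<phi> ` ?W \<subseteq> ball (\<phi> q) e" by blast
    then have "smooth_fun_on ?W (\<lambda>r. h i (\<phi> r))" for i
      by (intro smooth_fun_on_chart[OF U(1) W(1)] smooth_on_subset[OF h(1)]) auto
    then have hn: "smooth_near q (\<lambda>r. h i (\<phi> r))" for i
      using W(2) by (rule smooth_nearI)
    have xn: "smooth_near q (\<lambda>r. \<phi> r $ i - \<phi> q $ i)"
      and vx: "v (\<lambda>r. \<phi> r $ i - \<phi> q $ i) = coord_vec \<phi> v $ i" for i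
      using smooth_near_add[OF smooth_near_coordinate[OF U, of i] smooth_near_const[OF q, of "- \<phi> q $ i"]]
        tangent_diff[OF v smooth_near_coordinate[OF U, of i] smooth_near_const[OF q, of "\<phi> q $ i"]]
        tangent_const[OF v q]
      by (simp_all add: coord_vec_def)
    have "v f = v (\<lambda>r. f q + (\<Sum>i\<in>UNIV. (\<phi> r $ i - \<phi> q $ i) * h i (\<phi> r)))"
    proof (rule tangent_local[OF v W])
      fix r assume r: "r \<in> ?W"
      then show "f r = f q + (\<Sum>i\<in>UNIV. (\<phi> r $ i - \<phi> q $ i) * h i (\<phi> r))"
        using h(2)[of "\<phi> r"] chart_inv[OF U(1)] U(2) by simp
    qed
    also have "\<dots> = v (\<lambda>r. f q) + v (\<lambda>r. \<Sum>i\<in>UNIV. (\<phi> r $ i - \<phi> q $ i) * h i (\<phi> r))"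
      using tangent_sum[OF v q, of UNIV "\<lambda>i r. (\<phi> r $ i - \<phi> q $ i) * h i (\<phi> r)"]
        smooth_near_mult[OF xn hn]
      by (intro tangent_add[OF v smooth_near_const[OF q]]) auto
    also have "\<dots> = (\<Sum>i\<in>UNIV. v (\<lambda>r. (\<phi> r $ i - \<phi> q $ i) * h i (\<phi> r)))"
      using tangent_sum[OF v q, of UNIV "\<lambda>i r. (\<phi> r $ i - \<phi> q $ i) * h i (\<phi> r)"]
        smooth_near_mult[OF xn hn] tangent_const[OF v q] by simp
    also have "\<dots> = (\<Sum>i\<in>UNIV. coord_vec \<phi> v $ i * h i (\<phi> q))"
      by (intro sum.cong refl, subst tangent_mult[OF v xn hn]) (simp add: vx mult.commute)
    also have "\<dots> = frechet_derivative ?F (at (\<phi> q)) (coord_vec \<phi> v)"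
      unfolding h(3)
      by (rule frechet_derivative_axis_expansion[symmetric])
        (use smooth_near_has_derivative[OF True U] in \<open>auto simp: differentiable_def\<close>)
    finally show ?thesis
      using True by (simp add: tangent_of_def)
  qed (simp add: tangent_of_def tangent_not_smooth[OF v])
qed

lemma tangent_of_add:
  assumes "(U, \<phi>) \<in> A" "q \<in> U"
  shows "tangent_of U \<phi> q (w + z) = tangent_of U \<phi> q w + tangent_of U \<phi> q z"
  using linear_add[OF has_derivative_linear[OF smooth_near_has_derivative[OF _ assms]]]
  by (auto simp: tangent_of_def fun_eq_iff)

lemma tangent_of_scaleR:
  assumes "(U, \<phi>) \<in> A" "q \<in> U"
  shows "tangent_of U \<phi> q (c *\<^sub>R w) = c *\<^sub>R tangent_of U \<phi> q w"
  using linear_scale[OF has_derivative_linear[OF smooth_near_has_derivative[OF _ assms]]]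
  by (auto simp: tangent_of_def fun_eq_iff scaleR_fun_def)

lemma linear_tangent_of: "(U, \<phi>) \<in> A \<Longrightarrow> q \<in> U \<Longrightarrow> linear (tangent_of U \<phi> q)"
  by (simp add: linearI tangent_of_add tangent_of_scaleR)

lemma tangent_space_eq_range:
  assumes "(U, \<phi>) \<in> A" "q \<in> U"
  shows "tangent_space q = range (tangent_of U \<phi> q)"
  using tangent_of_in_tangent_space[OF assms] tangent_of_coord_vec[OF assms]
  by (metis (lifting) UNIV_eq_I image_subset_iff rangeI set_eq_subset subsetI)

lemma subspace_tangent_space:
  assumes "q \<in> topspace M"
  shows "subspace (tangent_space q)"
proof -
  obtain U \<phi> where U: "(U, \<phi>) \<in> A" "q \<in> U"
    using chart_at[OF assms] .
  show ?thesis
    unfolding tangent_space_eq_range[OF U]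
    using linear_tangent_of[OF U] by (intro linear_subspace_image) auto
qed

lemma coord_vec_inj:
  assumes "(U, \<phi>) \<in> A" "q \<in> U" "u \<in> tangent_space q" "v \<in> tangent_space q"
    "coord_vec \<phi> u = coord_vec \<phi> v"
  shows "u = v"
  using tangent_of_coord_vec[OF assms(1,2)] assms(3-5) by metis

end

section \<open>Vector fields and coordinate frames\<close>

lemma sum_fun_apply: "(\<Sum>i\<in>I. f i) x = (\<Sum>i\<in>I. f i x)"
  by (induction I rule: infinite_finite_induct) simp_all

text \<open>The connections, curvatures and metrics are known to be additive only on vector fields
  or on tangent spaces, so the library rules for linear maps do not apply; \<open>P\<close> carries
  this domain along.\<close>

lemma sum_additive_on:
  fixes f :: "'i \<Rightarrow> 'a::comm_monoid_add" and T :: "'a \<Rightarrow> 'b::comm_monoid_add"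
  assumes "P 0" "\<And>x y. P x \<Longrightarrow> P y \<Longrightarrow> P (x + y)" "T 0 = 0"
    "\<And>x y. P x \<Longrightarrow> P y \<Longrightarrow> T (x + y) = T x + T y" "\<And>i. i \<in> I \<Longrightarrow> P (f i)"
  shows "P (\<Sum>i\<in>I. f i) \<and> T (\<Sum>i\<in>I. f i) = (\<Sum>i\<in>I. T (f i))"
  using assms(5) by (induction I rule: infinite_finite_induct) (simp_all add: assms(1-4))

context smooth_manifold
begin

lemma vector_field_tangent: "vector_field X \<Longrightarrow> p \<in> topspace M \<Longrightarrow> X p \<in> tangent_space p"
  by (simp add: vector_field_def)

lemma vector_field_outside: "vector_field X \<Longrightarrow> p \<notin> topspace M \<Longrightarrow> X p = 0"
  by (simp add: vector_field_def)

lemma vector_field_smooth: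
  "vector_field X \<Longrightarrow> smooth_fun_on W f \<Longrightarrow> smooth_fun_on W (\<lambda>p. X p f)"
  by (simp add: vector_field_def apply_vf_def)

lemma vector_field_add:
  assumes "vector_field X" "vector_field Y"
  shows "vector_field (X + Y)"
  unfolding vector_field_def
  using subspace_add[OF subspace_tangent_space] vector_field_tangent[OF assms(1)]
    vector_field_tangent[OF assms(2)] vector_field_outside[OF assms(1)] vector_field_outside[OF assms(2)]
    smooth_fun_on_add[OF vector_field_smooth[OF assms(1)] vector_field_smooth[OF assms(2)]]
  by (auto simp: apply_vf_def)

lemma vector_field_scale:
  assumes "smooth_fun_on (topspace M) f" "vector_field X"
  shows "vector_field (scale_vf f X)"
proof -
  have "smooth_fun_on W f" if "smooth_fun_on W h" for W h
    using smooth_fun_on_subset[OF assms(1)] smooth_fun_on_openin[OF that] openin_subset by blast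
  then show ?thesis
    unfolding vector_field_def
    using subspace_scale[OF subspace_tangent_space] vector_field_tangent[OF assms(2)]
      vector_field_outside[OF assms(2)] smooth_fun_on_mult[OF _ vector_field_smooth[OF assms(2)]]
    by (auto simp: apply_vf_def scale_vf_def scaleR_fun_def)
qed

lemma vector_field_zero: "vector_field 0"
  unfolding vector_field_def
  using subspace_0[OF subspace_tangent_space]
  by (auto simp: apply_vf_def intro: smooth_fun_on_const smooth_fun_on_openin)

lemma vector_field_sum:
  "(\<And>i. i \<in> I \<Longrightarrow> vector_field (X i)) \<Longrightarrow> vector_field (\<Sum>i\<in>I. X i)"
  by (induction I rule: infinite_finite_induct) (simp_all add: vector_field_add vector_field_zero)

lemma vector_field_diff:
  assumes "vector_field X" "vector_field Y"
  shows "vector_field (X - Y)"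
proof -
  have "vector_field (X + scale_vf (\<lambda>_. - 1) Y)"
    by (intro vector_field_add vector_field_scale smooth_fun_on_const assms openin_topspace)
  moreover have "X + scale_vf (\<lambda>_. - 1) Y = X - Y"
    by (simp add: fun_eq_iff scale_vf_def scaleR_fun_def)
  ultimately show ?thesis by simp
qed

lemma smooth_fun_on_coord_vec:
  assumes "vector_field X" "(U, \<phi>) \<in> A"
  shows "smooth_fun_on U (\<lambda>q. coord_vec \<phi> (X q) $ i)"
  using vector_field_smooth[OF assms(1) smooth_fun_on_coordinate[OF assms(2)]]
  by (simp add: coord_vec_def)

lemma tangent_of_axis_expansion:
  assumes "(U, \<phi>) \<in> A" "q \<in> U" "v \<in> tangent_space q"
  shows "v = (\<Sum>i\<in>UNIV. coord_vec \<phi> v $ i *\<^sub>R tangent_of U \<phi> q (axis i 1))"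
proof -
  have "v = tangent_of U \<phi> q (\<Sum>i\<in>UNIV. coord_vec \<phi> v $ i *\<^sub>R axis i 1)"
    using tangent_of_coord_vec[OF assms]
    by (simp add: basis_expansion flip: scalar_mult_eq_scaleR)
  then show ?thesis
    by (simp add: linear_sum[OF linear_tangent_of[OF assms(1,2)]]
        linear_scale[OF linear_tangent_of[OF assms(1,2)]])
qed

text \<open>Independence of the trace from the basis that \<open>trace_on\<close> picks: expand each
  b in the coordinate frame and each T(e_i) in \<open>B\<close>, then exchange the sums. Linearity
  is required through \<open>tangent_of\<close> only, because \<open>T\<close> is arbitrary outside
  the tangent space.\<close>

lemma trace_on_tangent_space:
  assumes U: "(U, \<phi>) \<in> A" "q \<in> U"
    and T: "\<And>v. v \<in> tangent_space q \<Longrightarrow> T v \<in> tangent_space q"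
      "linear (\<lambda>w. T (tangent_of U \<phi> q w))"
  shows "trace_on (tangent_space q) T
    = (\<Sum>i\<in>UNIV. coord_vec \<phi> (T (tangent_of U \<phi> q (axis i 1))) $ i)"
proof -
  let ?V = "tangent_space q" and ?e = "\<lambda>i. tangent_of U \<phi> q (axis i 1)"
  let ?c = "\<lambda>v i. coord_vec \<phi> v $ i"
  have q: "q \<in> topspace M"
    using U chart_subset by blast
  define B where "B = (SOME B. independent B \<and> span B = ?V)"
  have "\<exists>B. independent B \<and> span B = ?V"
    using maximal_independent_subset[of ?V] span_minimal[OF _ subspace_tangent_space[OF q]]
    by (metis subset_antisym)
  then have B: "independent B" "span B = ?V"
    unfolding B_def by (metis (mono_tags, lifting) someI_ex)+
  have "?V \<subseteq> span (range ?e)"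
  proof
    fix v assume "v \<in> ?V"
    then have "v = (\<Sum>i\<in>UNIV. ?c v i *\<^sub>R ?e i)"
      by (rule tangent_of_axis_expansion[OF U])
    also have "\<dots> \<in> span (range ?e)"
      by (intro span_sum span_scale span_base) auto
    finally show "v \<in> span (range ?e)" .
  qed
  moreover have "B \<subseteq> ?V"
    using B(2) span_superset by blast
  \<comment> \<open>Finiteness is not part of what the choice of \<open>B\<close> guarantees; it
    follows because \<open>B\<close> is independent inside the span of the finite frame.\<close>
  ultimately have fin: "finite B"
    using independent_span_bound[OF _ B(1), of "range ?e"] by auto
  have e: "?e i \<in> ?V" for i
    using tangent_of_in_tangent_space[OF U] .
  have rep: "representation B (T b) b = (\<Sum>i\<in>UNIV. ?c b i * representation B (T (?e i)) b)" if "b \<in> B" for b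
  proof -
    have b: "b \<in> ?V"
      using \<open>B \<subseteq> ?V\<close> that by blast
    have "T b = T (tangent_of U \<phi> q (\<Sum>i\<in>UNIV. ?c b i *\<^sub>R axis i 1))"
      using tangent_of_coord_vec[OF U b]
      by (simp add: basis_expansion flip: scalar_mult_eq_scaleR)
    also have "\<dots> = (\<Sum>i\<in>UNIV. ?c b i *\<^sub>R T (?e i))"
      by (simp add: linear_sum[OF T(2)] linear_scale[OF T(2)])
    finally have "T b = (\<Sum>i\<in>UNIV. ?c b i *\<^sub>R T (?e i))" .
    moreover have "T (?e i) \<in> span B" for i
      using T(1)[OF e] B(2) by simp
    ultimately show ?thesis
      by (simp add: representation_sum[OF B(1)] representation_scale[OF B(1)] span_scale)
  qed
  have "trace_on ?V T = (\<Sum>b\<in>B. \<Sum>i\<in>UNIV. ?c b i * representation B (T (?e i)) b)"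
    by (simp add: trace_on_def Let_def rep flip: B_def)
  also have "\<dots> = (\<Sum>i\<in>UNIV. \<Sum>b\<in>B. representation B (T (?e i)) b * ?c b i)"
    by (subst sum.swap) (simp add: mult.commute)
  also have "\<dots> = (\<Sum>i\<in>UNIV. coord_vec \<phi> (\<Sum>b\<in>B. representation B (T (?e i)) b *\<^sub>R b) $ i)"
    by (simp add: coord_vec_sum coord_vec_scaleR)
  also have "\<dots> = (\<Sum>i\<in>UNIV. ?c (T (?e i)) i)"
    using T(1)[OF e] B(2) by (simp add: sum_representation_eq[OF B(1) _ fin])
  finally show ?thesis .
qed

text \<open>The coordinate fields times a bump function extend by zero to global fields, which a
  connection can differentiate. The neighbourhood is chosen with a ball as its image so that
  Poincare's lemma will apply.\<close>

lemma coordinate_frame: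
  assumes U: "(U, \<phi>) \<in> A" "p \<in> U"
  obtains N E e where "openin M N" "p \<in> N" "N \<subseteq> U" "e > 0" "\<phi> ` N = ball (\<phi> p) e" "\<And>i. vector_field (E i)"
    "\<And>q i. q \<in> N \<Longrightarrow> E i q = tangent_of U \<phi> q (axis i 1)"
proof -
  obtain \<eta> N K where \<eta>: "smooth_fun_on (topspace M) \<eta>" "openin M N" "p \<in> N" "N \<subseteq> K" "closedin M K" "K \<subseteq> U"
    "\<And>q. q \<in> N \<Longrightarrow> \<eta> q = 1" "\<And>q. q \<notin> K \<Longrightarrow> \<eta> q = 0"
    using smooth_bump[OF chart_domain[OF U(1)] U(2)] by metis
  define E where "E i q = (if q \<in> U then \<eta> q *\<^sub>R tangent_of U \<phi> q (axis i 1) else 0)" for i q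
  have smooth: "smooth_fun_on W (\<lambda>q. E i q f)" if f: "smooth_fun_on W f" for W f i
  proof (rule smooth_fun_on_local[OF smooth_fun_on_openin[OF f]])
    fix q assume q: "q \<in> W"
    note W = smooth_fun_on_openin[OF f]
    have UW: "openin M (U \<inter> W)"
      using W chart_domain[OF U(1)] by blast
    show "smooth_near q (\<lambda>q. E i q f)"
    proof (cases "q \<in> U")
      case True
      have "smooth_fun_on (U \<inter> W) (\<lambda>q. frechet_derivative (\<lambda>x. f (inv_into U \<phi> x)) (at (\<phi> q)) (axis i 1))"
        by (rule smooth_fun_on_chart[OF U(1) UW]) (auto intro: smooth_on_frechet_derivative smooth_fun_onD[OF f U(1)])
      moreover have "smooth_fun_on (U \<inter> W) \<eta>"
        using smooth_fun_on_subset[OF \<eta>(1) UW] openin_subset[OF W] by blast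
      ultimately have "smooth_fun_on (U \<inter> W)
          (\<lambda>q. \<eta> q * frechet_derivative (\<lambda>x. f (inv_into U \<phi> x)) (at (\<phi> q)) (axis i 1))"
        by (rule smooth_fun_on_mult[rotated])
      then have "smooth_fun_on (U \<inter> W) (\<lambda>q. E i q f)"
        by (rule smooth_fun_on_cong)
          (use smooth_nearI[OF f] in \<open>simp add: E_def scaleR_fun_def tangent_of_def\<close>)
      then show ?thesis
        by (rule smooth_nearI) (use True q in auto)
    next
      case False
      \<comment> \<open>A point outside \<open>U\<close> lies outside the closed set
        \<open>K\<close>, and off \<open>K\<close> the bump function, hence the field, is
        zero.\<close>
      have "smooth_fun_on (W - K) (\<lambda>q. E i q f)"
        by (rule smooth_fun_on_cong[OF smooth_fun_on_const[OF openin_diff[OF W \<eta>(5)]]])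
          (simp add: E_def scaleR_fun_def \<eta>(8))
      then show ?thesis
        by (rule smooth_nearI) (use False q \<eta>(6) in auto)
    qed
  qed
  have E: "vector_field (E i)" for i
    unfolding vector_field_def
    using smooth chart_subset[OF U(1)] subspace_0[OF subspace_tangent_space]
      subspace_scale[OF subspace_tangent_space] tangent_of_in_tangent_space[OF U(1)]
    by (auto simp: apply_vf_def E_def)
  have "open (\<phi> ` N)"
    using \<eta>(2,4,6) by (intro open_chart_image[OF U(1)]) auto
  then obtain e where e: "e > 0" "ball (\<phi> p) e \<subseteq> \<phi> ` N"
    using \<eta>(3) open_contains_ball by blast
  let ?N = "{q \<in> U. \<phi> q \<in> ball (\<phi> p) e}"
  have NN: "?N \<subseteq> N"
    using e(2) \<eta>(4,6) inj_onD[OF chart_inj[OF U(1)]] by blast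
  have im: "\<phi> ` ?N = ball (\<phi> p) e"
    using e(2) \<eta>(4,6) by blast
  show thesis
  proof (rule that[of ?N e E])
    show "openin M ?N"
      by (rule openin_chart_preimage[OF U(1) open_ball])
    show "E i q = tangent_of U \<phi> q (axis i 1)" if "q \<in> ?N" for i q
      using that NN \<eta>(7) by (auto simp: E_def)
  qed (use U e(1) im E in auto)
qed

end

text \<open>The fields \<open>E i\<close> are global, so that connections apply to them, but they
  are coordinate fields over \<open>N\<close> only. All frame identities are therefore claimed at
  points of \<open>N\<close>.\<close>

locale local_frame = smooth_manifold M A
  for M :: "'m topology" and A :: "('m set \<times> ('m \<Rightarrow> real^'n)) set" +
  fixes U :: "'m set" and \<phi> :: "'m \<Rightarrow> real^'n" and N :: "'m set" and E :: "'n \<Rightarrow> 'm vfield"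
  assumes chart: "(U, \<phi>) \<in> A"
    and N: "openin M N" "N \<subseteq> U"
    and vector_field_E: "vector_field (E i)"
    and E_eq: "q \<in> N \<Longrightarrow> E i q = tangent_of U \<phi> q (axis i 1)"
begin

abbreviation coord :: "'n \<Rightarrow> 'm tangent \<Rightarrow> real"
  where "coord i v \<equiv> coord_vec \<phi> v $ i"

lemma N_topspace: "q \<in> N \<Longrightarrow> q \<in> topspace M"
  using N chart_subset[OF chart] by blast

lemma N_U: "q \<in> N \<Longrightarrow> q \<in> U"
  using N by blast

lemma frame_expansion: "q \<in> N \<Longrightarrow> v \<in> tangent_space q \<Longrightarrow> v = (\<Sum>i\<in>UNIV. coord i v *\<^sub>R E i q)"
  using tangent_of_axis_expansion[OF chart N_U] by (simp add: E_eq)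

lemma coord_E: "q \<in> N \<Longrightarrow> coord j (E i q) = (if j = i then 1 else 0)"
  by (simp add: E_eq coord_vec_tangent_of[OF chart N_U] axis_def)

lemma smooth_fun_on_coord: "vector_field X \<Longrightarrow> smooth_fun_on N (\<lambda>q. coord i (X q))"
  using smooth_fun_on_subset[OF smooth_fun_on_coord_vec[OF _ chart] N] .

text \<open>The components of X are smooth only over the chart. After multiplication by a bump
  supported in \<open>N\<close> they become global functions, and the expansion turns into an
  identity of global fields to which the axioms of a connection apply.\<close>

lemma global_expansion:
  assumes X: "vector_field X" and q: "q \<in> N"
  obtains \<eta> f V where "smooth_fun_on (topspace M) \<eta>" "\<And>i. smooth_fun_on (topspace M) (f i)"
    "openin M V" "q \<in> V" "V \<subseteq> N" "\<And>r. r \<in> V \<Longrightarrow> \<eta> r = 1" "\<And>r i. r \<in> V \<Longrightarrow> f i r = coord i (X r)"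
    "scale_vf \<eta> X = (\<Sum>i\<in>UNIV. scale_vf (f i) (E i))"
proof -
  obtain \<eta> V K where \<eta>: "smooth_fun_on (topspace M) \<eta>" "openin M V" "q \<in> V" "V \<subseteq> K" "closedin M K" "K \<subseteq> N"
    "\<And>q. q \<in> V \<Longrightarrow> \<eta> q = 1" "\<And>q. q \<notin> K \<Longrightarrow> \<eta> q = 0"
    using smooth_bump[OF N(1) q] by metis
  define f where "f i r = (if r \<in> N then \<eta> r * coord i (X r) else 0)" for i r
  have "smooth_fun_on N \<eta>"
    using smooth_fun_on_subset[OF \<eta>(1) N(1)] openin_subset[OF N(1)] by blast
  then have f: "smooth_fun_on (topspace M) (f i)" for i
    by (intro smooth_fun_on_extend_zero[OF smooth_fun_on_mult[OF _ smooth_fun_on_coord[OF X]] \<eta>(5,6)])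
      (auto simp: f_def \<eta>(8))
  have "scale_vf \<eta> X = (\<Sum>i\<in>UNIV. scale_vf (f i) (E i))"
  proof
    fix r
    show "scale_vf \<eta> X r = (\<Sum>i\<in>UNIV. scale_vf (f i) (E i)) r"
    proof (cases "r \<in> N")
      case True
      have "scale_vf \<eta> X r = \<eta> r *\<^sub>R (\<Sum>i\<in>UNIV. coord i (X r) *\<^sub>R E i r)"
        using frame_expansion[OF True vector_field_tangent[OF X N_topspace[OF True]]]
        by (simp add: scale_vf_def)
      then show ?thesis
        using True by (simp add: sum_fun_apply scale_vf_def f_def scaleR_sum_right)
    next
      case False
      then have "\<eta> r = 0" using \<eta>(6,8) by blast
      then show ?thesis
        using False by (simp add: sum_fun_apply scale_vf_def f_def)
    qed
  qed
  then show thesis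
    using \<eta> f by (intro that[of \<eta> f V]) (auto simp: f_def)
qed

text \<open>\<open>T\<close> is meant to be a tensorial operation already evaluated at
  \<open>q\<close>, hence the factor \<open>f q\<close> in its scaling rule. As the bump equals 1 at
  \<open>q\<close>, replacing X by the expanded field changes nothing; so \<open>T X\<close> depends
  only on \<open>X q\<close>.\<close>

lemma tensor_expansion:
  fixes T :: "'m vfield \<Rightarrow> 'b::real_vector"
  assumes add: "\<And>X Y. vector_field X \<Longrightarrow> vector_field Y \<Longrightarrow> T (X + Y) = T X + T Y"
    and scale: "\<And>f X. smooth_fun_on (topspace M) f \<Longrightarrow> vector_field X \<Longrightarrow> T (scale_vf f X) = f q *\<^sub>R T X"
    and X: "vector_field X" and q: "q \<in> N"
  shows "T X = (\<Sum>i\<in>UNIV. coord i (X q) *\<^sub>R T (E i))"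
proof -
  obtain \<eta> f V where *: "smooth_fun_on (topspace M) \<eta>" "\<And>i. smooth_fun_on (topspace M) (f i)"
    "openin M V" "q \<in> V" "V \<subseteq> N" "\<And>r. r \<in> V \<Longrightarrow> \<eta> r = 1" "\<And>r i. r \<in> V \<Longrightarrow> f i r = coord i (X r)"
    "scale_vf \<eta> X = (\<Sum>i\<in>UNIV. scale_vf (f i) (E i))"
    by (rule global_expansion[OF X q]) blast
  have "scale_vf (\<lambda>_. 0) X = 0"
    by (simp add: scale_vf_def fun_eq_iff scaleR_fun_def)
  then have zero: "T 0 = 0"
    using scale[OF smooth_fun_on_const[OF openin_topspace] X, of 0] by simp
  have sum: "T (\<Sum>i\<in>I. Y i) = (\<Sum>i\<in>I. T (Y i))" if "\<And>i. vector_field (Y i)" for Y :: "'n \<Rightarrow> 'm vfield" and I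
    using sum_additive_on[of vector_field T I Y] that
    by (simp add: vector_field_zero vector_field_add zero add)
  have "T X = T (scale_vf \<eta> X)"
    using scale[OF *(1) X] *(4,6) by simp
  also have "\<dots> = (\<Sum>i\<in>UNIV. T (scale_vf (f i) (E i)))"
    unfolding *(8) by (intro sum vector_field_scale * vector_field_E)
  also have "\<dots> = (\<Sum>i\<in>UNIV. coord i (X q) *\<^sub>R T (E i))"
    using *(2,4,7) by (simp add: scale vector_field_E)
  finally show ?thesis .
qed

end

section \<open>Connections and curvature in a coordinate frame\<close>

text \<open>The hypothesis says that the transpose of \<open>S\<close> is minus the conjugate of
  \<open>S'\<close> by \<open>G\<close>, and traces ignore both transposition and conjugation.
  \<open>G\<close> will be a Gram matrix, \<open>S\<close> and \<open>S'\<close> the matrices of R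
  and R*.\<close>

lemma trace_adjoint_neg:
  fixes S S' G :: "real^'n^'n"
  assumes "invertible G" "transpose S ** G = - (G ** S')"
  shows "trace S = - trace S'"
proof -
  obtain G' where G': "G ** G' = mat 1" "G' ** G = mat 1"
    using assms(1) by (auto simp: invertible_def)
  have "transpose S = (transpose S ** G) ** G'"
    by (simp add: G' flip: matrix_mul_assoc)
  also have "\<dots> = - (G ** (S' ** G'))"
  proof -
    have "(- X) ** Y = - (X ** Y)" for X Y :: "real^'n^'n"
      by (simp add: vec_eq_iff matrix_matrix_mult_def sum_negf)
    then show ?thesis
      unfolding assms(2) by (simp add: matrix_mul_assoc)
  qed
  finally have "trace S = - trace (G ** (S' ** G'))"
    by (simp add: trace_def transpose_def vec_eq_iff sum_negf)
  also have "trace (G ** (S' ** G')) = trace S'"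
    by (subst trace_mul_sym) (simp add: G' flip: matrix_mul_assoc)
  finally show ?thesis .
qed

context smooth_manifold
begin

lemma connection_vector_field:
  "affine_connection D \<Longrightarrow> vector_field X \<Longrightarrow> vector_field Y \<Longrightarrow> vector_field (D X Y)"
  by (simp add: affine_connection_def)

lemma connection_add_left:
  "affine_connection D \<Longrightarrow> vector_field X \<Longrightarrow> vector_field X' \<Longrightarrow> vector_field Y \<Longrightarrow>
    D (X + X') Y = D X Y + D X' Y"
  by (simp add: affine_connection_def)

lemma connection_add_right:
  "affine_connection D \<Longrightarrow> vector_field X \<Longrightarrow> vector_field Y \<Longrightarrow> vector_field Y' \<Longrightarrow>
    D X (Y + Y') = D X Y + D X Y'"
  by (simp add: affine_connection_def)

lemma connection_diff_left:
  assumes "affine_connection D" "vector_field X" "vector_field X'" "vector_field Y"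
  shows "D (X - X') Y = D X Y - D X' Y"
  using connection_add_left[OF assms(1) vector_field_diff[OF assms(2,3)] assms(3,4)]
  by (simp add: eq_diff_eq)

lemma connection_diff_right:
  assumes "affine_connection D" "vector_field X" "vector_field Y" "vector_field Y'"
  shows "D X (Y - Y') = D X Y - D X Y'"
  using connection_add_right[OF assms(1,2) vector_field_diff[OF assms(3,4)] assms(4)]
  by (simp add: eq_diff_eq)

lemma connection_scale_left:
  "affine_connection D \<Longrightarrow> smooth_fun_on (topspace M) f \<Longrightarrow> vector_field X \<Longrightarrow> vector_field Y \<Longrightarrow>
    D (scale_vf f X) Y = scale_vf f (D X Y)"
  by (simp add: affine_connection_def)

lemma connection_scale_right:
  "affine_connection D \<Longrightarrow> smooth_fun_on (topspace M) f \<Longrightarrow> vector_field X \<Longrightarrow> vector_field Y \<Longrightarrow>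
    D X (scale_vf f Y) = scale_vf (apply_vf X f) Y + scale_vf f (D X Y)"
  by (simp add: affine_connection_def)

lemma connection_scale_right_at:
  assumes "affine_connection D" "smooth_fun_on (topspace M) f" "vector_field X" "vector_field Y"
  shows "D X (scale_vf f Y) q = X q f *\<^sub>R Y q + f q *\<^sub>R D X Y q"
  by (subst connection_scale_right[OF assms]) (simp only: plus_fun_apply scale_vf_def apply_vf_def)

lemma lie_bracket_connection:
  "torsion_free D \<Longrightarrow> vector_field X \<Longrightarrow> vector_field Y \<Longrightarrow> lie_bracket X Y = D X Y - D Y X"
  by (simp add: torsion_free_def)

lemma curvature_add_left:
  assumes D: "affine_connection D" "torsion_free D"
    and X: "vector_field X" "vector_field X'" and YZ: "vector_field Y" "vector_field Z"
  shows "curvature D (X + X') Y Z = curvature D X Y Z + curvature D X' Y Z"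
proof -
  note vf = connection_vector_field[OF D(1)] vector_field_diff vector_field_add X YZ
  have "lie_bracket (X + X') Y = lie_bracket X Y + lie_bracket X' Y"
    by (simp add: lie_bracket_connection[OF D(2)] connection_add_left[OF D(1)]
        connection_add_right[OF D(1)] vf)
  moreover have "vector_field (lie_bracket X Y)" "vector_field (lie_bracket X' Y)"
    by (simp_all add: lie_bracket_connection[OF D(2)] vf)
  ultimately show ?thesis
    by (simp add: curvature_def connection_add_left[OF D(1)] connection_add_right[OF D(1)] vf)
qed

text \<open>Two terms (Y f) D_X Z cancel: one from differentiating f D_X Z along Y, the other from
  [f X, Y] = f [X, Y] - (Y f) X. The latter formula is read off from the connection, as vanishing
  torsion expresses the bracket by \<open>D\<close>.\<close>

lemma curvature_scale_left:
  assumes D: "affine_connection D" "torsion_free D"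
    and f: "smooth_fun_on (topspace M) f" and X: "vector_field X" and YZ: "vector_field Y" "vector_field Z"
  shows "curvature D (scale_vf f X) Y Z q = f q *\<^sub>R curvature D X Y Z q"
proof -
  have Yf: "smooth_fun_on (topspace M) (apply_vf Y f)"
    using vector_field_smooth[OF YZ(1) f] by (simp add: apply_vf_def)
  note vf = connection_vector_field[OF D(1)] vector_field_diff vector_field_add
    vector_field_scale[OF f] vector_field_scale[OF Yf] X YZ
  note rules = connection_scale_left[OF D(1) f] connection_scale_left[OF D(1) Yf]
    connection_scale_right[OF D(1) f] connection_diff_left[OF D(1)] vf
  have "lie_bracket (scale_vf f X) Y = scale_vf f (lie_bracket X Y) - scale_vf (apply_vf Y f) X"
    by (simp add: lie_bracket_connection[OF D(2)] rules)
      (simp add: fun_eq_iff scale_vf_def algebra_simps)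
  moreover have "vector_field (lie_bracket X Y)"
    by (simp add: lie_bracket_connection[OF D(2)] vf)
  ultimately have "D (lie_bracket (scale_vf f X) Y) Z
      = scale_vf f (D (lie_bracket X Y) Z) - scale_vf (apply_vf Y f) (D X Z)"
    by (simp add: rules)
  then show ?thesis
    by (simp add: curvature_def rules) (simp add: scale_vf_def algebra_simps)
qed

lemma curvature_vector_field:
  assumes "affine_connection D" "torsion_free D" "vector_field X" "vector_field Y" "vector_field Z"
  shows "vector_field (curvature D X Y Z)"
  unfolding curvature_def lie_bracket_connection[OF assms(2-4)]
  by (intro vector_field_diff connection_vector_field[OF assms(1)] assms)

end

section \<open>Connection, Ricci tensor and curvature trace in components\<close>

context local_frame
begin

lemma connection_frame_left:
  assumes "affine_connection D" "vector_field X" "vector_field Y" "q \<in> N"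
  shows "D X Y q = (\<Sum>i\<in>UNIV. coord i (X q) *\<^sub>R D (E i) Y q)"
proof (rule tensor_expansion[where T = "\<lambda>X. D X Y q"])
  show "D (X + X') Y q = D X Y q + D X' Y q" if "vector_field X" "vector_field X'" for X X'
    by (simp only: connection_add_left[OF assms(1) that assms(3)] plus_fun_apply)
  show "D (scale_vf f X) Y q = f q *\<^sub>R D X Y q" if "smooth_fun_on (topspace M) f" "vector_field X" for f X
    by (subst connection_scale_left[OF assms(1) that assms(3)]) (simp only: scale_vf_def)
qed (use assms in auto)

text \<open>The differentiated slot is not tensorial, so agreement of the bump with 1 at
  \<open>q\<close> is not enough; it is 1 near \<open>q\<close>, which makes its derivative vanish
  there. The components of Y get differentiated and must likewise be matched on a
  neighbourhood.\<close>

lemma connection_frame_right: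
  assumes D: "affine_connection D" and X: "vector_field X" and Y: "vector_field Y" and q: "q \<in> N"
  shows "D X Y q = (\<Sum>j\<in>UNIV. X q (\<lambda>r. coord j (Y r)) *\<^sub>R E j q + coord j (Y q) *\<^sub>R D X (E j) q)"
proof -
  obtain \<eta> f V where *: "smooth_fun_on (topspace M) \<eta>" "\<And>i. smooth_fun_on (topspace M) (f i)"
    "openin M V" "q \<in> V" "V \<subseteq> N" "\<And>r. r \<in> V \<Longrightarrow> \<eta> r = 1" "\<And>r i. r \<in> V \<Longrightarrow> f i r = coord i (Y r)"
    "scale_vf \<eta> Y = (\<Sum>i\<in>UNIV. scale_vf (f i) (E i))"
    by (rule global_expansion[OF Y q]) blast
  note Xq = vector_field_tangent[OF X N_topspace[OF q]]
  have "scale_vf (\<lambda>_. 0) X = 0"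
    by (simp add: scale_vf_def fun_eq_iff scaleR_fun_def)
  then have zero: "D X 0 = 0"
    using connection_add_right[OF D X vector_field_zero vector_field_zero] by simp
  have sum: "D X (\<Sum>i\<in>I. Z i) = (\<Sum>i\<in>I. D X (Z i))" if "\<And>i. vector_field (Z i)" for Z :: "'n \<Rightarrow> 'm vfield" and I
    using sum_additive_on[of vector_field "D X" I Z] that
    by (simp add: vector_field_zero vector_field_add zero connection_add_right[OF D X])
  have "X q \<eta> = X q (\<lambda>r. 1)"
    by (rule tangent_local[OF Xq *(3,4)]) (simp add: *(6))
  then have "D X Y q = D X (scale_vf \<eta> Y) q"
    using *(4,6) tangent_const[OF Xq N_topspace[OF q]]
    by (simp add: connection_scale_right_at[OF D *(1) X Y])
  also have "\<dots> = (\<Sum>i\<in>UNIV. D X (scale_vf (f i) (E i)) q)"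
    unfolding *(8) by (subst sum) (simp_all add: vector_field_scale * vector_field_E sum_fun_apply)
  also have "\<dots> = (\<Sum>i\<in>UNIV. X q (f i) *\<^sub>R E i q + f i q *\<^sub>R D X (E i) q)"
    by (simp only: connection_scale_right_at[OF D *(2) X vector_field_E])
  also have "\<dots> = (\<Sum>j\<in>UNIV. X q (\<lambda>r. coord j (Y r)) *\<^sub>R E j q + coord j (Y q) *\<^sub>R D X (E j) q)"
    using tangent_local[OF Xq *(3,4) *(7)] *(4,7) by simp
  finally show ?thesis .
qed

lemma coord_connection:
  assumes "affine_connection D" "vector_field X" "vector_field Y" "q \<in> N"
  shows "coord k (D X Y q)
    = X q (\<lambda>r. coord k (Y r)) + (\<Sum>j\<in>UNIV. coord j (Y q) * coord k (D X (E j) q))"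
  by (subst connection_frame_right[OF assms])
    (simp add: coord_vec_sum coord_vec_add coord_vec_scaleR sum.distrib coord_E[OF assms(4)] if_distrib
      cong: if_cong)

lemma connection_eq_0_left:
  assumes "affine_connection D" "vector_field X" "vector_field Y" "q \<in> N" "X q = 0"
  shows "D X Y q = 0"
  by (subst connection_frame_left[OF assms(1-4)]) (simp add: assms(5) coord_vec_zero)

text \<open>In contrast to the left slot, Y is taken to vanish on all of \<open>N\<close>, since the
  derivatives of its components enter.\<close>

lemma connection_eq_0_right:
  assumes D: "affine_connection D" "vector_field X" "vector_field Y" "q \<in> N"
    and Y: "\<And>r. r \<in> N \<Longrightarrow> Y r = 0"
  shows "D X Y q = 0"
proof -
  note Xq = vector_field_tangent[OF D(2) N_topspace[OF D(4)]]
  have "X q (\<lambda>r. coord j (Y r)) = X q (\<lambda>r. 0)" for j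
    by (rule tangent_local[OF Xq N(1) D(4)]) (simp add: Y coord_vec_zero)
  then show ?thesis
    by (subst connection_frame_right[OF D])
      (simp add: Y[OF D(4)] coord_vec_zero tangent_const[OF Xq N_topspace[OF D(4)]])
qed

text \<open>Applied to a coordinate function, \<open>E j\<close> gives a constant 0 or 1 over
  \<open>N\<close>, which \<open>E i\<close> annihilates. That this determines the bracket needs it
  to be a tangent vector; for this the bracket is written as a difference of two fields built with
  \<open>D\<close>.\<close>

lemma lie_bracket_frame:
  assumes D: "affine_connection D" "torsion_free D" and q: "q \<in> N"
  shows "lie_bracket (E i) (E j) q = 0"
proof (rule coord_vec_inj[OF chart N_U[OF q]])
  note qM = N_topspace[OF q]
  have "vector_field (lie_bracket (E i) (E j))"
    by (simp add: lie_bracket_connection[OF D(2)] vector_field_E vector_field_diff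
        connection_vector_field[OF D(1)])
  then show "lie_bracket (E i) (E j) q \<in> tangent_space q"
    using qM by (rule vector_field_tangent)
  show "0 \<in> tangent_space q"
    by (rule subspace_0[OF subspace_tangent_space[OF qM]])
  have *: "E i q (\<lambda>r. E j r (\<lambda>q. \<phi> q $ k)) = 0" for i j k
  proof -
    note Eq = vector_field_tangent[OF vector_field_E qM]
    have "E i q (\<lambda>r. E j r (\<lambda>q. \<phi> q $ k)) = E i q (\<lambda>r. if k = j then 1 else 0)"
      using coord_E by (intro tangent_local[OF Eq N(1) q]) (simp add: coord_vec_def)
    then show ?thesis
      using tangent_const[OF Eq qM] by simp
  qed
  show "coord_vec \<phi> (lie_bracket (E i) (E j) q) = coord_vec \<phi> 0"
    using * by (simp add: coord_vec_def lie_bracket_def apply_vf_def vec_eq_iff)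
qed

text \<open>The endomorphism in \<open>Ric\<close> depends on an extension picked by choice.
  Tensoriality of the curvature makes the pick irrelevant and the endomorphism linear on the tangent
  space, so that its trace can be taken in the frame.\<close>

lemma Ric_frame:
  assumes D: "affine_connection D" "torsion_free D" and YZ: "vector_field Y" "vector_field Z" and q: "q \<in> N"
  shows "Ric D Y Z q = (\<Sum>i\<in>UNIV. coord i (curvature D (E i) Y Z q))"
proof -
  define T where "T v = curvature D (SOME X. vector_field X \<and> X q = v) Y Z q" for v
  have T: "T v = (\<Sum>i\<in>UNIV. coord i v *\<^sub>R curvature D (E i) Y Z q)" if v: "v \<in> tangent_space q" for v
  proof -
    \<comment> \<open>The combination of the \<open>E i\<close> with constant coefficients shows
      that an extension of \<open>v\<close> exists, so the chosen one has the required
      properties.\<close>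
    let ?X = "\<Sum>i\<in>UNIV. scale_vf (\<lambda>_. coord i v) (E i)"
    have "vector_field ?X"
      by (intro vector_field_sum vector_field_scale smooth_fun_on_const openin_topspace vector_field_E)
    moreover have "?X q = v"
      using frame_expansion[OF q v] by (simp add: sum_fun_apply scale_vf_def)
    ultimately have X: "vector_field (SOME X. vector_field X \<and> X q = v)" "(SOME X. vector_field X \<and> X q = v) q = v"
      by (metis (mono_tags, lifting) someI_ex)+
    show ?thesis
      unfolding T_def
    proof (subst tensor_expansion[where T = "\<lambda>X. curvature D X Y Z q" and q = q])
      show "curvature D (X + X') Y Z q = curvature D X Y Z q + curvature D X' Y Z q"
        if "vector_field X" "vector_field X'" for X X'
        by (simp only: curvature_add_left[OF D that YZ] plus_fun_apply)
      show "curvature D (scale_vf f X) Y Z q = f q *\<^sub>R curvature D X Y Z q"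
        if "smooth_fun_on (topspace M) f" "vector_field X" for f X
        by (rule curvature_scale_left[OF D that YZ])
    qed (simp_all add: q X)
  qed
  have tan: "tangent_of U \<phi> q w \<in> tangent_space q" for w
    by (rule tangent_of_in_tangent_space[OF chart N_U[OF q]])
  have R: "curvature D (E i) Y Z q \<in> tangent_space q" for i
    by (rule vector_field_tangent[OF curvature_vector_field[OF D vector_field_E YZ] N_topspace[OF q]])
  have "Ric D Y Z q = trace_on (tangent_space q) T"
    by (simp add: Ric_def T_def[abs_def])
  also have "\<dots> = (\<Sum>i\<in>UNIV. coord i (T (tangent_of U \<phi> q (axis i 1))))"
  proof (rule trace_on_tangent_space[OF chart N_U[OF q]])
    show "T v \<in> tangent_space q" if "v \<in> tangent_space q" for v
      unfolding T[OF that]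
      using subspace_tangent_space[OF N_topspace[OF q]] R by (intro subspace_sum subspace_scale)
    show "linear (\<lambda>w. T (tangent_of U \<phi> q w))"
      by (rule linearI) (simp_all add: T[OF tan] coord_vec_tangent_of[OF chart N_U[OF q]]
          scaleR_left_distrib sum.distrib scaleR_sum_right)
  qed
  also have "\<dots> = (\<Sum>i\<in>UNIV. coord i (curvature D (E i) Y Z q))"
  proof (intro sum.cong refl)
    fix i
    have "T (tangent_of U \<phi> q (axis i 1)) = (\<Sum>j\<in>UNIV. axis i 1 $ j *\<^sub>R curvature D (E j) Y Z q)"
      by (simp add: T[OF tan] coord_vec_tangent_of[OF chart N_U[OF q]])
    also have "\<dots> = (\<Sum>j\<in>UNIV. if j = i then curvature D (E j) Y Z q else 0)"
      by (intro sum.cong) (auto simp: axis_def)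
    finally show "coord i (T (tangent_of U \<phi> q (axis i 1))) = coord i (curvature D (E i) Y Z q)"
      by simp
  qed
  finally show ?thesis .
qed

text \<open>The bracket occupies the tensorial slot, so its vanishing at the single point
  \<open>q\<close> removes the third term.\<close>

lemma curvature_frame:
  assumes D: "affine_connection D" "torsion_free D" and q: "q \<in> N"
  shows "curvature D (E i) (E j) (E k) q = D (E i) (D (E j) (E k)) q - D (E j) (D (E i) (E k)) q"
proof -
  have "vector_field (lie_bracket (E i) (E j))"
    by (simp add: lie_bracket_connection[OF D(2)] vector_field_E vector_field_diff
        connection_vector_field[OF D(1)])
  then have "D (lie_bracket (E i) (E j)) (E k) q = 0"
    by (rule connection_eq_0_left[where D = D, OF D(1) _ vector_field_E q]) (rule lie_bracket_frame[OF D q])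
  then show ?thesis
    by (simp add: curvature_def)
qed

text \<open>For commuting fields, vanishing torsion makes D_b E_c symmetric in b and c over all of
  \<open>N\<close>, hence also its derivative along E_a. The six second derivatives in the cyclic
  sum then cancel in pairs.\<close>

lemma Bianchi_frame:
  assumes D: "affine_connection D" "torsion_free D" and q: "q \<in> N"
  shows "curvature D (E i) (E j) (E k) q + curvature D (E j) (E k) (E i) q
    + curvature D (E k) (E i) (E j) q = 0"
proof -
  note vf = connection_vector_field[OF D(1)] vector_field_E vector_field_diff
  have *: "D (E a) (D (E b) (E c)) q - D (E a) (D (E c) (E b)) q = 0" for a b c
  proof -
    have "D (E a) (D (E b) (E c) - D (E c) (E b)) q = 0"
      by (rule connection_eq_0_right[OF D(1) _ _ q])
        (use lie_bracket_frame[OF D] in \<open>simp_all add: vf lie_bracket_connection[OF D(2)]\<close>)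
    then show ?thesis
      by (simp add: connection_diff_right[OF D(1)] vf)
  qed
  show ?thesis
    using *[of i j k] *[of j k i] *[of k i j]
    by (simp add: curvature_frame[OF D q] algebra_simps)
qed

text \<open>Antisymmetry in the first two slots turns R(i,j)k - R(i,k)j into two of the three
  Bianchi terms; taking the i-th component and summing over i yields the trace.\<close>

lemma Ric_antisymmetric_part:
  assumes D: "affine_connection D" "torsion_free D" and q: "q \<in> N"
  shows "Ric D (E j) (E k) q - Ric D (E k) (E j) q
    = - (\<Sum>i\<in>UNIV. coord i (curvature D (E j) (E k) (E i) q))"
proof -
  let ?R = "\<lambda>i j k. curvature D (E i) (E j) (E k) q"
  have *: "?R i j k - ?R i k j = - ?R j k i" for i
  proof -
    have "?R i k j = - ?R k i j"
      by (simp add: curvature_frame[OF D q])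
    then have "?R i j k - ?R i k j = ?R i j k + ?R k i j"
      by simp
    also have "\<dots> = - ?R j k i"
      using Bianchi_frame[OF D q, of i j k] by (simp only: eq_neg_iff_add_eq_0 add_ac)
    finally show ?thesis .
  qed
  have "coord i (?R i j k) - coord i (?R i k j) = - coord i (?R j k i)" for i
    using arg_cong[OF *, of "coord i" i] coord_vec_diff[of \<phi> 0 "?R j k i"]
    by (simp add: coord_vec_diff coord_vec_zero)
  then show ?thesis
    by (simp add: Ric_frame[OF D _ _ q] vector_field_E flip: sum_subtractf sum_negf)
qed

text \<open>The contracted Christoffel symbols \<Gamma>^i_(k i). They form the connection form of
  the bundle of top-degree forms, up to sign: the coordinate volume form has derivative
  \<open>- trace_form D k\<close> times itself along \<open>E k\<close>.\<close>

definition trace_form :: "('m vfield \<Rightarrow> 'm vfield \<Rightarrow> 'm vfield) \<Rightarrow> 'n \<Rightarrow> 'm \<Rightarrow> real"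
  where "trace_form D k q = (\<Sum>i\<in>UNIV. coord i (D (E k) (E i) q))"

lemma smooth_fun_on_trace_form:
  assumes "affine_connection D"
  shows "smooth_fun_on N (trace_form D k)"
  unfolding trace_form_def[abs_def]
  by (rule smooth_fun_on_sum[OF N(1) smooth_fun_on_coord[OF connection_vector_field[OF assms
          vector_field_E vector_field_E]]])

text \<open>A second covariant derivative contributes the derivative of \<open>trace_form\<close>
  plus the trace of a product of two connection matrices. The latter is symmetric in j and k, as
  tr(AB) = tr(BA), and drops out of the difference.\<close>

lemma trace_curvature_frame:
  assumes D: "affine_connection D" "torsion_free D" and q: "q \<in> N"
  shows "(\<Sum>i\<in>UNIV. coord i (curvature D (E j) (E k) (E i) q))
    = E j q (trace_form D k) - E k q (trace_form D j)"
proof -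
  have *: "(\<Sum>i\<in>UNIV. coord i (D (E j) (D (E k) (E i)) q)) = E j q (trace_form D k)
      + (\<Sum>i\<in>UNIV. \<Sum>m\<in>UNIV. coord m (D (E k) (E i) q) * coord i (D (E j) (E m) q))" for j k
  proof -
    note vf = connection_vector_field[OF D(1) vector_field_E vector_field_E]
    have "E j q (trace_form D k) = (\<Sum>i\<in>UNIV. E j q (\<lambda>r. coord i (D (E k) (E i) r)))"
      unfolding trace_form_def[abs_def]
      by (rule tangent_sum[OF vector_field_tangent[OF vector_field_E N_topspace[OF q]]
            N_topspace[OF q], THEN conjunct1])
        (rule smooth_nearI[OF smooth_fun_on_coord[OF vf] q])
    then show ?thesis
      by (simp add: coord_connection[OF D(1) vector_field_E vf q] sum.distrib)
  qed
  have "(\<Sum>i\<in>UNIV. \<Sum>m\<in>UNIV. coord m (D (E k) (E i) q) * coord i (D (E j) (E m) q))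
      = (\<Sum>i\<in>UNIV. \<Sum>m\<in>UNIV. coord m (D (E j) (E i) q) * coord i (D (E k) (E m) q))"
    by (subst sum.swap) (simp only: mult.commute)
  then show ?thesis
    by (simp add: curvature_frame[OF D q] coord_vec_diff sum_subtractf *)
qed

end

section \<open>Determinants and the dual connection\<close>

text \<open>The form with one replaced row at a time matches \<open>cov_deriv_form\<close>, where
  one argument of the volume form at a time is replaced by its covariant derivative.\<close>

lemma has_derivative_det:
  fixes a :: "'n::finite \<Rightarrow> 'n \<Rightarrow> 'a::real_normed_vector \<Rightarrow> real"
  assumes "\<And>i j. (a i j has_derivative a' i j) (at x)"
  shows "((\<lambda>x. det (\<chi> i j. a i j x)) has_derivative
    (\<lambda>v. \<Sum>i\<in>UNIV. det (\<chi> k j. if k = i then a' i j v else a k j x))) (at x)"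
proof -
  have "((\<lambda>x. \<Sum>p | p permutes UNIV. of_int (sign p) * (\<Prod>i\<in>UNIV. a i (p i) x)) has_derivative
      (\<lambda>v. \<Sum>p | p permutes UNIV. of_int (sign p) *
        (\<Sum>i\<in>UNIV. a' i (p i) v * (\<Prod>k\<in>UNIV - {i}. a k (p k) x)))) (at x)"
    by (intro has_derivative_sum has_derivative_mult_right has_derivative_prod assms)
  moreover have "(\<Prod>k\<in>UNIV. if k = i then a' i (p k) v else a k (p k) x)
      = a' i (p i) v * (\<Prod>k\<in>UNIV - {i}. a k (p k) x)" for i p v
    by (subst prod.remove[of _ i]) (auto intro!: prod.cong)
  ultimately show ?thesis
    by (simp add: det_def sum_distrib_left sum.swap[of _ "{p. p permutes UNIV}" UNIV])
qed

text \<open>Cramer's rule for the identity matrix: \<open>x\<close> is the combination of its rows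
  with coefficients \<open>x $ l\<close>, and only the coefficient of row i survives.\<close>

lemma det_mat_1_replace_row:
  fixes x :: "real^'n"
  shows "det (\<chi> k j. if k = i then x $ j else if k = j then 1 else 0) = x $ i"
proof -
  have *: "(\<chi> k j. if k = i then x $ j else if k = j then 1 else 0) =
      (\<chi> k. if k = i then sum (\<lambda>l. x $ l *s row l (mat 1)) UNIV else row k (mat 1))"
    by (auto simp: vec_eq_iff row_def mat_def if_distrib cong: if_cong)
  show ?thesis
    unfolding * cramer_lemma_transpose by simp
qed

text \<open>Both sides are the derivative of \<open>det (B ** (mat 1 + t *\<^sub>R A))\<close> at \<open>t = 0\<close>.\<close>

lemma sum_det_replace_row_mult:
  fixes A B :: "real^'n^'n"
  shows "(\<Sum>i\<in>UNIV. det (\<chi> k j. if k = i then (B ** A) $ i $ j else B $ k $ j)) = trace A * det B"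
proof -
  have aff: "((\<lambda>t::real. c + t * d) has_derivative (\<lambda>t. t * d)) (at 0)" for c d
    by (auto intro!: derivative_eq_intros)
  have "((\<lambda>t. det (\<chi> i j. B $ i $ j + t * (B ** A) $ i $ j)) has_derivative
      (\<lambda>t. \<Sum>i\<in>UNIV. det (\<chi> k j. if k = i then t * (B ** A) $ i $ j else B $ k $ j + 0 * (B ** A) $ k $ j))) (at 0)"
    by (rule has_derivative_det[OF aff])
  moreover have "(\<chi> i j. B $ i $ j + t * (B ** A) $ i $ j)
      = B ** (\<chi> i j. (if i = j then 1 else 0) + t * A $ i $ j)" for t
    by (simp add: vec_eq_iff matrix_matrix_mult_def distrib_left sum.distrib sum_distrib_left
        mult_delta_right mult.left_commute)
  moreover have "((\<lambda>t. det B * det (\<chi> i j. (if i = j then 1 else 0) + t * A $ i $ j)) has_derivative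
      (\<lambda>t. det B * (\<Sum>i\<in>UNIV. det (\<chi> k j. if k = i then t * A $ i $ j
        else (if k = j then 1 else 0) + 0 * A $ k $ j)))) (at 0)"
    by (intro has_derivative_mult_right has_derivative_det aff)
  ultimately have "(\<lambda>t. \<Sum>i\<in>UNIV. det (\<chi> k j. if k = i then t * (B ** A) $ i $ j else B $ k $ j + 0 * (B ** A) $ k $ j))
    = (\<lambda>t. det B * (\<Sum>i\<in>UNIV. det (\<chi> k j. if k = i then t * A $ i $ j
        else (if k = j then 1 else 0) + 0 * A $ k $ j)))"
    by (simp only: det_mul) (rule has_derivative_unique)
  from fun_cong[OF this, of 1] show ?thesis
    by (simp add: det_mat_1_replace_row trace_def mult.commute cong: if_cong)
qed

context smooth_manifold
begin

lemma smooth_fun_on_det: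
  fixes a :: "'k::finite \<Rightarrow> 'k \<Rightarrow> 'm \<Rightarrow> real"
  assumes "openin M W" "\<And>i j. smooth_fun_on W (a i j)"
  shows "smooth_fun_on W (\<lambda>r. det (\<chi> i j. a i j r))"
  unfolding det_def
  using assms by (intro smooth_fun_on_sum smooth_fun_on_mult smooth_fun_on_prod smooth_fun_on_const) simp_all

lemma metric_add_right:
  assumes "riemannian_metric g" "p \<in> topspace M" "u \<in> tangent_space p" "v \<in> tangent_space p" "w \<in> tangent_space p"
  shows "g p u (v + w) = g p u v + g p u w"
  using assms by (auto simp: riemannian_metric_def linear_map_on_def)

lemma metric_scale_right:
  assumes "riemannian_metric g" "p \<in> topspace M" "u \<in> tangent_space p" "v \<in> tangent_space p"
  shows "g p u (c *\<^sub>R v) = c * g p u v"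
  using assms by (auto simp: riemannian_metric_def linear_map_on_def)

lemma metric_sym:
  assumes "riemannian_metric g" "p \<in> topspace M" "u \<in> tangent_space p" "v \<in> tangent_space p"
  shows "g p u v = g p v u"
  using assms by (auto simp: riemannian_metric_def)

lemma metric_pos:
  assumes "riemannian_metric g" "p \<in> topspace M" "v \<in> tangent_space p" "v \<noteq> 0"
  shows "g p v v > 0"
  using assms by (auto simp: riemannian_metric_def)

lemma metric_diff_right:
  assumes "riemannian_metric g" "p \<in> topspace M" "u \<in> tangent_space p" "v \<in> tangent_space p" "w \<in> tangent_space p"
  shows "g p u (v - w) = g p u v - g p u w"
proof -
  have "v - w \<in> tangent_space p"
    using subspace_diff[OF subspace_tangent_space] assms by blast
  from metric_add_right[OF assms(1-3) this assms(5)] show ?thesis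
    by (simp only: diff_add_cancel)
qed

lemma metric_sum_right:
  assumes "riemannian_metric g" "p \<in> topspace M" "u \<in> tangent_space p" "\<And>i. i \<in> I \<Longrightarrow> v i \<in> tangent_space p"
  shows "g p u (\<Sum>i\<in>I. c i *\<^sub>R v i) = (\<Sum>i\<in>I. c i * g p u (v i))"
proof -
  note sub = subspace_tangent_space[OF assms(2)]
  have "g p u (\<Sum>i\<in>I. c i *\<^sub>R v i) = (\<Sum>i\<in>I. g p u (c i *\<^sub>R v i))"
  proof (rule sum_additive_on[where P = "\<lambda>v. v \<in> tangent_space p", THEN conjunct2])
    show "g p u 0 = 0"
      using metric_scale_right[OF assms(1-3) subspace_0[OF sub], of 0] by simp
    show "x + y \<in> tangent_space p" "g p u (x + y) = g p u x + g p u y"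
      if "x \<in> tangent_space p" "y \<in> tangent_space p" for x y
      by (rule subspace_add[OF sub that], rule metric_add_right[OF assms(1-3) that])
    show "c i *\<^sub>R v i \<in> tangent_space p" if "i \<in> I" for i
      by (rule subspace_scale[OF sub assms(4)[OF that]])
  qed (rule subspace_0[OF sub])
  also have "\<dots> = (\<Sum>i\<in>I. c i * g p u (v i))"
    by (rule sum.cong[OF refl], rule metric_scale_right[OF assms(1-3) assms(4)])
  finally show ?thesis .
qed

lemma metric_smooth:
  "riemannian_metric g \<Longrightarrow> vector_field X \<Longrightarrow> vector_field Y \<Longrightarrow>
    smooth_fun_on (topspace M) (\<lambda>p. g p (X p) (Y p))"
  by (simp add: riemannian_metric_def)

end

section \<open>The torsion of the dual connection\<close>

context statistical_manifold
begin

text \<open>In terms of the dual connection the cubic form is \<open>Q(X,Y,Z) = g(Y, nab'\<^sub>X Z - nab\<^sub>X Z)\<close>.\<close>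

lemma dual_connection_torsion_free:
  assumes dual: "dual_connection g nab nab'"
  shows "torsion_free nab'"
  unfolding torsion_free_def
proof (intro allI impI)
  fix X Z assume X: "vector_field X" and Z: "vector_field Z"
  have D': "affine_connection nab'"
    using dual by (simp add: dual_connection_def)
  note vf = connection_vector_field[OF connection] connection_vector_field[OF D'] vector_field_diff X Z
  \<comment> \<open>The torsion of \<open>nab'\<close> minus that of \<open>nab\<close>, the
    brackets cancelling. Being a global vector field, it may itself be inserted into the cubic form,
    and pairing it with itself forces it to be zero.\<close>
  define W where "W = (nab' X Z - nab X Z) - (nab' Z X - nab Z X)"
  have W: "vector_field W"
    unfolding W_def by (intro vf)
  have Q: "cubic_form g nab X Y Z p = g p (Y p) (nab' X Z p - nab X Z p)"
    if "vector_field X" "vector_field Y" "vector_field Z" "p \<in> topspace M" for X Y Z p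
  proof -
    have "X p (\<lambda>q. g q (Y q) (Z q)) = g p (nab X Y p) (Z p) + g p (Y p) (nab' X Z p)"
      using dual that unfolding dual_connection_def by blast
    moreover have "g p (Y p) (nab' X Z p - nab X Z p) = g p (Y p) (nab' X Z p) - g p (Y p) (nab X Z p)"
      using that by (intro metric_diff_right[OF metric] vector_field_tangent
          connection_vector_field[OF connection] connection_vector_field[OF D'])
    ultimately show ?thesis
      by (simp add: cubic_form_def)
  qed
  have "W p = 0" for p
  proof (cases "p \<in> topspace M")
    case p: True
    have tan: "nab' X Z p - nab X Z p \<in> tangent_space p" "nab' Z X p - nab Z X p \<in> tangent_space p"
      by (intro subspace_diff[OF subspace_tangent_space[OF p]] vector_field_tangent[OF _ p] vf)+
    \<comment> \<open>The outer slots are exchanged by three adjacent swaps: (X,W,Z), (X,Z,W),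
      (Z,X,W), (Z,W,X).\<close>
    have "cubic_form g nab X W Z p = cubic_form g nab Z W X p"
      using cubic_form_symmetric[OF X W Z p, THEN conjunct2]
        cubic_form_symmetric[OF X Z W p, THEN conjunct1]
        cubic_form_symmetric[OF Z X W p, THEN conjunct2] by (rule trans[OF trans])
    then have "g p (W p) (nab' X Z p - nab X Z p) = g p (W p) (nab' Z X p - nab Z X p)"
      by (simp add: Q X Z W p)
    then have "g p (W p) ((nab' X Z p - nab X Z p) - (nab' Z X p - nab Z X p)) = 0"
      using metric_diff_right[OF metric p vector_field_tangent[OF W p] tan] by simp
    then have "g p (W p) (W p) = 0"
      by (simp add: W_def)
    then show ?thesis
      using metric_pos[OF metric p vector_field_tangent[OF W p]] by force
  next
    case False
    then show ?thesis
      using vector_field_outside[OF W] by blast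
  qed
  then have "W = 0"
    by (simp only: fun_eq_iff zero_fun_apply) simp
  then have "nab' X Z - nab X Z = nab' Z X - nab Z X"
    by (simp only: W_def right_minus_eq)
  then have "nab' X Z - nab' Z X = nab X Z - nab Z X"
    by (simp only: diff_eq_eq) (simp only: add.commute add.left_commute diff_conv_add_uminus add.assoc)
  then show "nab' X Z - nab' Z X = lie_bracket X Z"
    using lie_bracket_connection[OF torsion_free X Z] by simp
qed

end

section \<open>Traces of the dual curvatures\<close>

context local_frame
begin

text \<open>Differentiate g(E_a, E_b) along E_k and then along E_j. Each step puts
  \<open>nab\<close> on the left factor and \<open>nab'\<close> on the right one; the mixed terms
  are symmetric in j and k. As E_j and E_k commute at \<open>q\<close>, antisymmetrising leaves only
  the two curvature terms.\<close>

lemma curvature_duality: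
  assumes g: "riemannian_metric g" and D: "affine_connection nab" "torsion_free nab"
    and dual: "dual_connection g nab nab'" and D': "torsion_free nab'" and q: "q \<in> N"
  shows "g q (curvature nab (E j) (E k) (E a) q) (E b q)
    = - g q (E a q) (curvature nab' (E j) (E k) (E b) q)"
proof -
  have D'1: "affine_connection nab'"
    using dual by (simp add: dual_connection_def)
  note p = N_topspace[OF q]
  note vf = connection_vector_field[OF D(1)] connection_vector_field[OF D'1] vector_field_E
  note tan = vector_field_tangent[OF _ p]
  have dualE: "X r (\<lambda>q. g q (Y q) (Z q)) = g r (nab X Y r) (Z r) + g r (Y r) (nab' X Z r)"
    if "vector_field X" "vector_field Y" "vector_field Z" "r \<in> topspace M" for X Y Z r
    using dual that unfolding dual_connection_def by blast
  let ?h = "\<lambda>q. g q (E a q) (E b q)"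
  have second: "E j q (\<lambda>r. E k r ?h) = g q (nab (E j) (nab (E k) (E a)) q) (E b q)
      + g q (nab (E k) (E a) q) (nab' (E j) (E b) q) + g q (nab (E j) (E a) q) (nab' (E k) (E b) q)
      + g q (E a q) (nab' (E j) (nab' (E k) (E b)) q)" for j k
  proof -
    have "E j q (\<lambda>r. E k r ?h)
        = E j q (\<lambda>r. g r (nab (E k) (E a) r) (E b r) + g r (E a r) (nab' (E k) (E b) r))"
      by (rule tangent_local[OF tan[OF vector_field_E] openin_topspace p]) (simp add: dualE vf)
    also have "\<dots> = E j q (\<lambda>r. g r (nab (E k) (E a) r) (E b r))
        + E j q (\<lambda>r. g r (E a r) (nab' (E k) (E b) r))"
      by (rule tangent_add[OF tan[OF vector_field_E]])
        (rule smooth_nearI[OF metric_smooth[OF g] p]; intro vf)+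
    finally show ?thesis
      by (simp add: dualE vf p)
  qed
  \<comment> \<open>Without this \<open>lie_bracket\<close> would return its default value 0, and
    its vanishing would say nothing about the second derivatives.\<close>
  have "smooth_near q ?h"
    by (rule smooth_nearI[OF metric_smooth[OF g vector_field_E vector_field_E] p])
  then have "E j q (\<lambda>r. E k r ?h) - E k q (\<lambda>r. E j r ?h) = 0"
    using fun_cong[OF lie_bracket_frame[OF D q, of j k], of ?h]
    by (simp add: lie_bracket_def apply_vf_def)
  moreover have "g q (curvature nab (E j) (E k) (E a) q) (E b q)
      = g q (nab (E j) (nab (E k) (E a)) q) (E b q) - g q (nab (E k) (nab (E j) (E a)) q) (E b q)"
  proof -
    have t: "nab (E j) (nab (E k) (E a)) q \<in> tangent_space q" for j k
      by (intro tan vf)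
    have "g q (curvature nab (E j) (E k) (E a) q) (E b q) = g q (E b q) (curvature nab (E j) (E k) (E a) q)"
      by (intro metric_sym[OF g p] tan vf curvature_vector_field D)
    also have "\<dots> = g q (E b q) (nab (E j) (nab (E k) (E a)) q) - g q (E b q) (nab (E k) (nab (E j) (E a)) q)"
      unfolding curvature_frame[OF D q] by (intro metric_diff_right[OF g p] tan vf)
    finally show ?thesis
      using metric_sym[OF g p tan[OF vector_field_E] t] by simp
  qed
  moreover have "g q (E a q) (curvature nab' (E j) (E k) (E b) q)
      = g q (E a q) (nab' (E j) (nab' (E k) (E b)) q) - g q (E a q) (nab' (E k) (nab' (E j) (E b)) q)"
    unfolding curvature_frame[OF D'1 D' q] by (intro metric_diff_right[OF g p] tan vf)
  ultimately show ?thesis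
    by (simp add: second)
qed

text \<open>A kernel vector is the component vector of a tangent vector orthogonal to the whole
  frame, hence to itself, so positivity makes it zero.\<close>

lemma Gram_matrix_invertible:
  assumes g: "riemannian_metric g" and q: "q \<in> N"
  shows "invertible (\<chi> a b. g q (E a q) (E b q))"
proof -
  let ?G = "\<chi> a b. g q (E a q) (E b q)"
  note p = N_topspace[OF q]
  have E: "E a q \<in> tangent_space q" for a
    by (rule vector_field_tangent[OF vector_field_E p])
  have "x = 0" if "?G *v x = 0" for x
  proof -
    let ?v = "\<Sum>b\<in>UNIV. x $ b *\<^sub>R E b q"
    have v: "?v \<in> tangent_space q"
      using subspace_tangent_space[OF p] E by (intro subspace_sum subspace_scale)
    have "g q (E a q) ?v = (?G *v x) $ a" for a
      by (simp add: metric_sum_right[OF g p E E] matrix_vector_mult_def mult.commute)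
    then have "g q ?v (E a q) = 0" for a
      using that metric_sym[OF g p v E] by simp
    then have "g q ?v ?v = 0"
      by (simp add: metric_sum_right[OF g p v E])
    then have v0: "?v = 0"
      using metric_pos[OF g p v] by force
    have "x $ a = coord a ?v" for a
      by (simp add: coord_vec_sum coord_vec_scaleR coord_E[OF q] if_distrib cong: if_cong)
    then show ?thesis
      unfolding v0 by (simp add: vec_eq_iff coord_vec_zero)
  qed
  then have "\<exists>B. B ** ?G = mat 1"
    by (simp add: matrix_left_invertible_ker)
  then show ?thesis
    by (simp add: invertible_left_inverse)
qed

text \<open>In matrices, the (a, b) entry of transpose S ** G is g(R E_a, E_b) and that of G ** S'
  is g(E_a, R* E_b), so \<open>curvature_duality\<close> is the hypothesis of
  \<open>trace_adjoint_neg\<close>.\<close>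

lemma trace_curvature_dual:
  assumes g: "riemannian_metric g" and D: "affine_connection nab" "torsion_free nab"
    and dual: "dual_connection g nab nab'" and D': "torsion_free nab'" and q: "q \<in> N"
  shows "(\<Sum>i\<in>UNIV. coord i (curvature nab (E j) (E k) (E i) q))
    = - (\<Sum>i\<in>UNIV. coord i (curvature nab' (E j) (E k) (E i) q))"
proof -
  let ?G = "\<chi> a b. g q (E a q) (E b q)"
  let ?S = "\<lambda>D. (\<chi> l i. coord l (curvature D (E j) (E k) (E i) q)) :: real^'n^'n"
  have D'1: "affine_connection nab'"
    using dual by (simp add: dual_connection_def)
  note p = N_topspace[OF q]
  have E: "E a q \<in> tangent_space q" for a
    by (rule vector_field_tangent[OF vector_field_E p])
  have expand: "g q (E b q) v = (\<Sum>l\<in>UNIV. coord l v * g q (E b q) (E l q))" if "v \<in> tangent_space q" for v b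
    by (subst frame_expansion[OF q that]) (rule metric_sum_right[OF g p E E])
  have R: "curvature nab (E j) (E k) (E a) q \<in> tangent_space q"
    "curvature nab' (E j) (E k) (E a) q \<in> tangent_space q" for a
    by (rule vector_field_tangent[OF curvature_vector_field p]; intro D D' D'1 vector_field_E)+
  have "g q (E b q) (curvature nab (E j) (E k) (E a) q) = - g q (E a q) (curvature nab' (E j) (E k) (E b) q)" for a b
    using curvature_duality[OF g D dual D' q] metric_sym[OF g p E R(1)] by simp
  then have "transpose (?S nab) ** ?G = - (?G ** ?S nab')"
    using metric_sym[OF g p E E]
    by (simp add: vec_eq_iff matrix_matrix_mult_def transpose_def expand[OF R(1)] expand[OF R(2)] mult.commute)
  from trace_adjoint_neg[OF Gram_matrix_invertible[OF g q] this] show ?thesis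
    by (simp add: trace_def)
qed

section \<open>Volume forms with a density and their parallelism\<close>

lemma tangent_eq_derivative:
  assumes "q \<in> N" "v \<in> tangent_space q" "smooth_near q f"
    "((\<lambda>x. f (inv_into U \<phi> x)) has_derivative D) (at (\<phi> q))"
  shows "v f = D (coord_vec \<phi> v)"
  using tangent_ofI[OF assms(3,4)] tangent_of_coord_vec[OF chart N_U[OF assms(1)] assms(2)] by metis

lemma tangent_det:
  fixes a :: "'k::finite \<Rightarrow> 'k \<Rightarrow> 'm \<Rightarrow> real"
  assumes q: "q \<in> N" and v: "v \<in> tangent_space q" and a: "\<And>i j. smooth_fun_on N (a i j)"
  shows "v (\<lambda>r. det (\<chi> i j. a i j r)) = (\<Sum>i\<in>UNIV. det (\<chi> k j. if k = i then v (a i j) else a k j q))"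
proof -
  have sm: "smooth_near q (a i j)" for i j
    by (rule smooth_nearI[OF a q])
  note d = smooth_near_has_derivative[OF sm chart N_U[OF q]]
  have "((\<lambda>x. det (\<chi> i j. a i j (inv_into U \<phi> x))) has_derivative (\<lambda>w. \<Sum>i\<in>UNIV. det (\<chi> k j. if k = i
      then frechet_derivative (\<lambda>x. a i j (inv_into U \<phi> x)) (at (\<phi> q)) w
      else a k j (inv_into U \<phi> (\<phi> q))))) (at (\<phi> q))"
    by (rule has_derivative_det[OF d])
  from tangent_eq_derivative[OF q v smooth_nearI[OF smooth_fun_on_det[of N a, OF N(1) a] q] this]
  show ?thesis
    by (simp add: tangent_eq_derivative[OF q v sm d] chart_inv[OF chart N_U[OF q]] cong: if_cong)
qed

text \<open>The form h dx_1 \<and> ... \<and> dx_n in the given chart, whose value on the frame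
  itself is \<open>h\<close>.\<close>

definition volume :: "('m \<Rightarrow> real) \<Rightarrow> 'm \<Rightarrow> ('n \<Rightarrow> 'm tangent) \<Rightarrow> real"
  where "volume h q v = h q * det (\<chi> i j. coord j (v i))"

lemma volume_form_on_volume:
  assumes h: "smooth_fun_on N h" "\<And>q. q \<in> N \<Longrightarrow> h q \<noteq> 0"
  shows "volume_form_on N (volume h)"
  unfolding volume_form_on_def
proof (intro conjI ballI allI impI)
  fix p and v :: "'n \<Rightarrow> 'm tangent" and i assume "p \<in> N"
  have upd: "(\<chi> k j. coord j ((v(i := u)) k)) = (\<chi> k. if k = i then coord_vec \<phi> u else coord_vec \<phi> (v k))" for u
    by (simp add: vec_eq_iff)
  show "linear_map_on (tangent_space p) (\<lambda>u. volume h p (v(i := u)))"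
    unfolding linear_map_on_def volume_def upd
    by (simp add: coord_vec_add coord_vec_scaleR det_row_add det_row_mul algebra_simps
        flip: scalar_mult_eq_scaleR cong: if_cong)
  show "volume h p v = 0" if "i \<noteq> j" "v i = v j" for j
    unfolding volume_def
    using that by (subst det_identical_rows[of i j]) (auto simp: row_def)
next
  fix p assume p: "p \<in> N"
  have "(\<chi> i j. coord j (E i p)) = mat 1"
    by (simp add: vec_eq_iff mat_def coord_E[OF p] eq_commute)
  then have "volume h p (\<lambda>i. E i p) \<noteq> 0"
    using h(2)[OF p] by (simp add: volume_def)
  then show "\<exists>v. (\<forall>i. v i \<in> tangent_space p) \<and> volume h p v \<noteq> 0"
    using vector_field_tangent[OF vector_field_E N_topspace[OF p]]
    by (intro exI[of _ "\<lambda>i. E i p"]) simp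
next
  fix Y :: "'n \<Rightarrow> 'm vfield" assume Y: "\<forall>i. vector_field (Y i)"
  show "smooth_fun_on N (\<lambda>p. volume h p (\<lambda>i. Y i p))"
    unfolding volume_def
    by (intro smooth_fun_on_mult h(1) smooth_fun_on_det N(1) smooth_fun_on_coord Y[rule_format])
qed

text \<open>Let the rows of B be the components of the Y_i and those of C the components of D_X E_m.
  The components of D_X Y_i are dY_i plus row i of B C. Replacing rows of B by those of B C sums to
  trace C * det B, and trace C is the trace form of X, so these terms are exactly matched by the
  derivative of \<open>h\<close> given in \<open>dh\<close>.\<close>

lemma parallel_on_volume:
  assumes D: "affine_connection D" and h: "smooth_fun_on N h"
    and dh: "\<And>X q. vector_field X \<Longrightarrow> q \<in> N \<Longrightarrow>
      X q h = h q * (\<Sum>k\<in>UNIV. coord k (X q) * trace_form D k q)"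
  shows "parallel_on D N (volume h)"
  unfolding parallel_on_def
proof (intro allI impI ballI)
  fix X :: "'m vfield" and Y :: "'n \<Rightarrow> 'm vfield" and q
  assume X: "vector_field X" and "\<forall>i. vector_field (Y i)" and q: "q \<in> N"
  then have Y: "vector_field (Y i)" for i
    by blast
  note Xq = vector_field_tangent[OF X N_topspace[OF q]]
  define B :: "real^'n^'n" where "B = (\<chi> i j. coord j (Y i q))"
  define C :: "real^'n^'n" where "C = (\<chi> m j. coord j (D X (E m) q))"
  define dY where "dY i = (\<chi> j. X q (\<lambda>r. coord j (Y i r)))" for i
  have tr: "trace C = (\<Sum>k\<in>UNIV. coord k (X q) * trace_form D k q)"
  proof -
    have "trace C = (\<Sum>m\<in>UNIV. \<Sum>k\<in>UNIV. coord k (X q) * coord m (D (E k) (E m) q))"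
      unfolding trace_def C_def
      by (subst connection_frame_left[OF D X vector_field_E q])
        (simp add: coord_vec_sum coord_vec_scaleR)
    also have "\<dots> = (\<Sum>k\<in>UNIV. coord k (X q) * trace_form D k q)"
      by (subst sum.swap) (simp add: trace_form_def sum_distrib_left)
    finally show ?thesis .
  qed
  have det: "X q (\<lambda>r. det (\<chi> i j. coord j (Y i r))) = (\<Sum>i\<in>UNIV. det (\<chi> k. if k = i then dY i else B $ k))"
  proof -
    have "(\<chi> k j. if k = i then X q (\<lambda>r. coord j (Y i r)) else coord j (Y k q))
        = (\<chi> k. if k = i then dY i else B $ k)" for i
      by (auto simp: vec_eq_iff dY_def B_def)
    then show ?thesis
      by (simp only: tangent_det[OF q Xq smooth_fun_on_coord[OF Y]])
  qed
  have "X q (\<lambda>r. volume h r (\<lambda>j. Y j r)) = h q * X q (\<lambda>r. det (\<chi> i j. coord j (Y i r))) + det B * X q h"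
    unfolding volume_def B_def
    by (intro tangent_mult[OF Xq] smooth_nearI[OF _ q] h smooth_fun_on_det N(1) smooth_fun_on_coord Y)
  also have "\<dots> = h q * ((\<Sum>i\<in>UNIV. det (\<chi> k. if k = i then dY i else B $ k)) + trace C * det B)"
    by (simp only: det dh[OF X q] tr) (simp add: algebra_simps)
  also have "trace C * det B = (\<Sum>i\<in>UNIV. det (\<chi> k. if k = i then (B ** C) $ i else B $ k))"
  proof -
    have "(\<chi> k j. if k = i then (B ** C) $ i $ j else B $ k $ j) = (\<chi> k. if k = i then (B ** C) $ i else B $ k)" for i
      by (auto simp: vec_eq_iff)
    then show ?thesis
      by (simp only: flip: sum_det_replace_row_mult)
  qed
  also have "(\<Sum>i\<in>UNIV. det (\<chi> k. if k = i then dY i else B $ k)) + \<dots>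
      = (\<Sum>i\<in>UNIV. det (\<chi> k. if k = i then dY i + (B ** C) $ i else B $ k))"
    by (simp add: det_row_add flip: sum.distrib)
  also have "h q * \<dots> = (\<Sum>i\<in>UNIV. volume h q ((\<lambda>j. Y j q)(i := D X (Y i) q)))"
  proof -
    have "(\<chi> k. if k = i then dY i + (B ** C) $ i else B $ k)
        = (\<chi> k j. coord j (((\<lambda>j. Y j q)(i := D X (Y i) q)) k))" for i
      by (auto simp: vec_eq_iff dY_def B_def C_def matrix_matrix_mult_def coord_connection[OF D X Y q])
    then show ?thesis
      by (simp only: volume_def sum_distrib_left)
  qed
  finally show "cov_deriv_form D (volume h) X Y q = 0"
    by (simp add: cov_deriv_form_def)
qed

text \<open>The logarithm of the density of the parallel form is a potential of the closed 1-form
  \<open>trace_form D\<close>.\<close>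

lemma parallel_volume_form_exists:
  assumes D: "affine_connection D" and im: "\<phi> ` N = ball a e" "e > 0"
    and closed: "\<And>q j k. q \<in> N \<Longrightarrow> E j q (trace_form D k) = E k q (trace_form D j)"
  obtains \<omega> where "volume_form_on N \<omega>" "parallel_on D N \<omega>"
proof -
  let ?t = "\<lambda>k x. trace_form D k (inv_into U \<phi> x)"
  have UN: "U \<inter> N = N"
    using N(2) by blast
  have t: "smooth_on (ball a e) (?t k)" for k
    using smooth_fun_onD[OF smooth_fun_on_trace_form[OF D] chart] by (simp add: UN im)
  have near: "smooth_near q (trace_form D k)" if "q \<in> N" for q k
    by (rule smooth_nearI[OF smooth_fun_on_trace_form[OF D] that])
  \<comment> \<open>Turns the frame derivatives in the hypothesis \<open>closed\<close> into the
    partial derivatives that Poincare's lemma speaks of.\<close>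
  have Et: "frechet_derivative (?t k) (at (\<phi> q)) (axis j 1) = E j q (trace_form D k)" if "q \<in> N" for q j k
    using near[OF that] by (simp add: E_eq[OF that] tangent_of_def)
  obtain P where P: "smooth_on (ball a e) P"
    "\<And>x. x \<in> ball a e \<Longrightarrow> (P has_derivative (\<lambda>v. \<Sum>i\<in>UNIV. v $ i * ?t i x)) (at x)"
  proof (rule Poincare_lemma_1_forms[OF open_ball convex_ball centre_in_ball[THEN iffD2, OF im(2)] t])
    fix x i j assume "x \<in> ball a e"
    then have "x \<in> \<phi> ` N"
      by (simp only: im(1))
    then obtain q where q: "q \<in> N" "x = \<phi> q"
      by (rule imageE)
    show "frechet_derivative (?t i) (at x) (axis j 1) = frechet_derivative (?t j) (at x) (axis i 1)"
      unfolding q(2) Et[OF q(1)] by (rule closed[OF q(1)])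
  next
    fix P assume "smooth_on (ball a e) P"
      "\<And>x. x \<in> ball a e \<Longrightarrow> (P has_derivative (\<lambda>v. \<Sum>i\<in>UNIV. v $ i * ?t i x)) (at x)"
    then show thesis by (rule that)
  qed
  define h where "h q = exp (P (\<phi> q))" for q
  have h: "smooth_fun_on N h"
    unfolding h_def
    by (rule smooth_fun_on_compose[OF smooth_fun_on_chart[OF chart N] smooth_on_exp]) (simp add: im P(1))
  have dh: "X q h = h q * (\<Sum>k\<in>UNIV. coord k (X q) * trace_form D k q)" if X: "vector_field X" and q: "q \<in> N" for X q
  proof -
    have x: "\<phi> q \<in> ball a e"
      using im(1) q by blast
    have "((\<lambda>x. exp (P x)) has_derivative (\<lambda>v. exp (P (\<phi> q)) * (\<Sum>i\<in>UNIV. v $ i * ?t i (\<phi> q)))) (at (\<phi> q))"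
      using has_derivative_exp[OF P(2)[OF x]] by (simp add: mult.commute)
    then have "((\<lambda>x. h (inv_into U \<phi> x)) has_derivative
        (\<lambda>v. exp (P (\<phi> q)) * (\<Sum>i\<in>UNIV. v $ i * ?t i (\<phi> q)))) (at (\<phi> q))"
    proof (rule has_derivative_transform_within_open[OF _ open_ball x])
      fix x assume "x \<in> ball a e"
      then have "x \<in> \<phi> ` U"
        using im(1) N(2) by blast
      then show "exp (P x) = h (inv_into U \<phi> x)"
        by (simp add: h_def f_inv_into_f)
    qed
    from tangent_eq_derivative[OF q vector_field_tangent[OF X N_topspace[OF q]] smooth_nearI[OF h q] this]
    show ?thesis
      by (simp add: h_def[abs_def] chart_inv[OF chart N_U[OF q]])
  qed
  show thesis
  proof (rule that)
    show "volume_form_on N (volume h)"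
      by (rule volume_form_on_volume[OF h]) (simp add: h_def)
    show "parallel_on D N (volume h)"
      by (rule parallel_on_volume[where h = h, OF D h]) (rule dh)
  qed
qed

end

theorem theorem3p1:
  fixes M :: "'m topology"
    and A :: "('m set \<times> ('m \<Rightarrow> real^'n::finite)) set"
    and g :: "'m \<Rightarrow> 'm tangent \<Rightarrow> 'm tangent \<Rightarrow> real"
    and nab nab' :: "'m vfield \<Rightarrow> 'm vfield \<Rightarrow> 'm vfield"
  assumes "statistical_manifold M A g nab"
    and "smooth_manifold.dual_connection M A g nab nab'"
    and "smooth_manifold.conjugate_Ricci_symmetric M A nab nab'"
  shows "smooth_manifold.equiaffine M A nab"
proof -
  interpret statistical_manifold M A g nab
    by (rule assms(1))
  note D = connection torsion_free
  \<comment> \<open>The Ricci identity below is needed for \<open>nab'\<close> as well, and for it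
    the absence of torsion.\<close>
  have dual: "affine_connection nab'" "torsion_free nab'"
    using assms(2) dual_connection_torsion_free by (auto simp: dual_connection_def)
  have "\<exists>U \<omega>. openin M U \<and> p \<in> U \<and> volume_form_on U \<omega> \<and> parallel_on nab U \<omega>" if p: "p \<in> topspace M" for p
  proof -
    obtain U \<phi> where U: "(U, \<phi>) \<in> A" "p \<in> U"
      using chart_at[OF p] .
    obtain N E e where nbhd: "openin M N" "p \<in> N" "N \<subseteq> U" "e > 0" "\<phi> ` N = ball (\<phi> p) e"
      and frame: "\<And>i. vector_field (E i)" "\<And>q i. q \<in> N \<Longrightarrow> E i q = tangent_of U \<phi> q (axis i 1)"
      by (rule coordinate_frame[OF U]) blast
    interpret local_frame M A U \<phi> N E
      by unfold_locales (use U nbhd frame in auto)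
    have "E j q (trace_form nab k) = E k q (trace_form nab j)" if q: "q \<in> N" for q j k
    proof -
      let ?S = "\<lambda>D. \<Sum>i\<in>UNIV. coord i (curvature D (E j) (E k) (E i) q)"
      have "Ric nab Y Z q = Ric nab' Y Z q" if "vector_field Y" "vector_field Z" for Y Z
        using assms(3) that N_topspace[OF q] by (simp add: conjugate_Ricci_symmetric_def)
      \<comment> \<open>Both Ricci tensors agree on (E_j, E_k) and on (E_k, E_j), hence so do their
        antisymmetric parts; no symmetry of either tensor is assumed.\<close>
      then have "?S nab = ?S nab'"
        using Ric_antisymmetric_part[OF D q, of j k] Ric_antisymmetric_part[OF dual q, of j k] frame(1) by simp
      moreover have "?S nab = - ?S nab'"
        by (rule trace_curvature_dual[OF metric D assms(2) dual(2) q])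
      ultimately have "?S nab = 0" by simp
      then show ?thesis
        using trace_curvature_frame[OF D q] by simp
    qed
    then obtain \<omega> where "volume_form_on N \<omega>" "parallel_on nab N \<omega>"
      by (rule parallel_volume_form_exists[OF connection nbhd(5,4)]) blast
    then show ?thesis
      using nbhd(1,2) by blast
  qed
  then show ?thesis
    using D by (simp add: equiaffine_def)
qed

end
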